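(* Let $\theta=\begin{pmatrix}1&0\\0&0\end{pmatrix}$. Any one-input linear control system $\Sigma_{\mathrm{Aff}(\mathbb{R})\times S^1}$ on $\mathrm{Aff}(\mathbb{R})\times S^1$, with linear vector field determined by $(A,\xi)$, satisfying the LARC, admits a unique control set with nonempty interior $\mathcal{C}_{\mathrm{Aff}(\mathbb{R})\times S^1}$, and it satisfies $$\mathcal{C}_{\mathrm{Aff}(\mathbb{R})\times S^1}=\pi_1^{-1}(\mathcal{C}_{\mathrm{Aff}(\mathbb{R})})=\mathcal{C}_{\mathrm{Aff}(\mathbb{R})}\times S^1,$$ where $\pi_1:\mathrm{Aff}(\mathbb{R})\times S^1\to\mathrm{Aff}(\mathbb{R})$ is the canonical projection and $\mathcal{C}_{\mathrm{Aff}(\mathbb{R})}$ is the unique control set with nonempty interior of the linear control system on $\mathrm{Aff}(\mathbb{R})$ that is $\pi_1$-conjugated to $\Sigma_{\mathrm{Aff}(\mathbb{R})\times S^1}$. Moreover, $\mathcal{C}_{\mathrm{Aff}(\mathbb{R})\times S^1}$ is open if $\mathrm{tr}\,A>0$, closed if $\mathrm{tr}\,A<0$, and equal to $\mathrm{Aff}(\mathbb{R})\times S^1$ if $\mathrm{tr}\,A=0$.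
   Context: **Groups.** $\mathrm{Aff}(\mathbb{R})$ is $\mathbb{R}\times\mathbb{R}$ with product $(t_1,x_1)(t_2,x_2)=(t_1+t_2,x_1+e^{t_1}x_2)$. For $\theta=\begin{pmatrix}1&0\\0&0\end{pmatrix}$ and $\rho_t=e^{t\theta}$, the group $G(\theta)$ ($\mathbb{R}\times\mathbb{R}^2$ with product $(t_1,v_1)(t_2,v_2)=(t_1+t_2,v_1+\rho_{t_1}v_2)$) is isomorphic to $\mathrm{Aff}(\mathbb{R})\times\mathbb{R}$ via $(t,xe_1+ye_2)\mapsto((t,x),y)$. $\mathrm{Aff}(\mathbb{R})\times S^1$ is the quotient of $\mathrm{Aff}(\mathbb{R})\times\mathbb{R}$ by $\{((0,0),2k\pi):k\in\mathbb{Z}\}$, with $S^1=\mathbb{R}/2\pi\mathbb{Z}$; its points are written $((t,x),[y])$, and $\pi_1((t,x),[y])=(t,x)$. **Linear control systems.** The linear vector fields on $\mathrm{Aff}(\mathbb{R})\times S^1$ are the projections of the linear vector fields $\mathcal{X}(t,v)=(0,Av+\Lambda_t^\theta\xi)$ on $G(\theta)$, where $\Lambda_t^\theta\xi=\int_0^te^{s\theta}\xi\,ds$, $\xi=(\xi_1,\xi_2)\in\mathbb{R}^2$, $A\theta=\theta A$ and $Ae_2=0$; hence $A=\mathrm{diag}(\lambda,0)$ with $\lambda=\mathrm{tr}\,A$. The left-invariant vector fields are the projections of $Y(t,v)=(\alpha,\rho_t\eta)$, $\alpha\in\mathbb{R}$, $\eta=(\eta_1,\eta_2)\in\mathbb{R}^2$.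 A one-input linear control system on $\mathrm{Aff}(\mathbb{R})\times S^1$ is $\dot g=\mathcal{X}(g)+uY(g)$, i.e. $$\dot t=u\alpha,\quad \dot x=\lambda x+(e^t-1)\xi_1+ue^t\eta_1,\quad \dot{[y]}=t\xi_2+u\eta_2,$$ with $u\in\Omega=[u^-,u^+]$, $u^-<0<u^+$. The $\pi_1$-conjugated system on $\mathrm{Aff}(\mathbb{R})$ consists of the first two equations. **Control systems.** For a system $\dot x=f_0(x)+u f_1(x)$ on a manifold $M$, $\mathcal{U}$ is the set of piecewise constant functions $\mathbf{u}$ with values in $\Omega$, and $\phi(s,x,\mathbf{u})$ is the solution with $\phi(0,x,\mathbf{u})=x$ (defined for all $s\in\mathbb{R}$). $\mathcal{O}^+(x)=\{\phi(S,x,\mathbf{u}):S>0,\mathbf{u}\in\mathcal{U}\}$. The system satisfies the Lie algebra rank condition (LARC) if the smallest Lie algebra of vector fields containing $f_0,f_1$ spans $T_xM$ at every $x\in M$. A subset $D\subset M$ is a control set if (i) for every $x\in D$ there is $\mathbf{u}\in\mathcal{U}$ with $\phi(\mathbb{R}^+,x,\mathbf{u})\subset D$; (ii) $D\subset\overline{\mathcal{O}^+(x)}$ for every $x\in D$; (iii) $D$ is maximal with respect to (i) and (ii). *)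

theory Defs
  imports "HOL-Analysis.Analysis"
begin

section \<open>The circle \<open>\<real>/2\<pi>\<int>\<close>\<close>

quotient_type circle = real / "\<lambda>a b. \<exists>k::int. a - b = 2 * pi * of_int k"
proof (rule equivpI)
  show "reflp (\<lambda>a b. \<exists>k::int. a - b = 2 * pi * of_int k)"
    by (rule reflpI) (rule exI[of _ 0], simp)
  show "symp (\<lambda>a b. \<exists>k::int. a - b = 2 * pi * of_int k)"
  proof (rule sympI)
    fix a b :: real assume "\<exists>k::int. a - b = 2 * pi * of_int k"
    then obtain k :: int where "a - b = 2 * pi * of_int k" by blast
    then have "b - a = 2 * pi * of_int (- k)" by simp
    then show "\<exists>k::int. b - a = 2 * pi * of_int k" by blast
  qed
  show "transp (\<lambda>a b. \<exists>k::int. a - b = 2 * pi * of_int k)"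
  proof (rule transpI)
    fix a b c :: real
    assume "\<exists>k::int. a - b = 2 * pi * of_int k" "\<exists>k::int. b - c = 2 * pi * of_int k"
    then obtain k l :: int where "a - b = 2 * pi * of_int k" "b - c = 2 * pi * of_int l" by blast
    then have "a - c = 2 * pi * of_int (k + l)" by (simp add: algebra_simps)
    then show "\<exists>k::int. a - c = 2 * pi * of_int k" by blast
  qed
qed

text \<open>The quotient topology.\<close>

instantiation circle :: topological_space
begin

definition open_circle :: "circle set \<Rightarrow> bool"
  where "open_circle U \<longleftrightarrow> open (abs_circle -` U)"

instance
proof
  show "open (UNIV :: circle set)" by (simp add: open_circle_def)
next
  fix S T :: "circle set" assume "open S" "open T"
  then show "open (S \<inter> T)" by (simp add: open_circle_def vimage_Int open_Int)
next
  fix K :: "circle set set" assume "\<forall>S\<in>K. open S"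
  then show "open (\<Union>K)" by (auto simp: open_circle_def vimage_Union intro!: open_UN)
qed

end

lift_definition rotate_circle :: "circle \<Rightarrow> real \<Rightarrow> circle" is "\<lambda>y c. y + c"
  by simp


section \<open>Control-affine systems\<close>

text \<open>
  The manifolds below are \<open>\<real>\<^sup>2\<close> and \<open>\<real>\<^sup>2 \<times> \<real>/2\<pi>\<int>\<close>. The differentiable structure of such a manifold
  \<open>'m\<close> is given by an argument \<open>sh :: 'm \<Rightarrow> 'e \<Rightarrow> 'm\<close>: for each point \<open>m\<close> the map \<open>v \<mapsto> sh m v\<close>
  (translation of \<open>m\<close> by \<open>v\<close>), restricted to a neighbourhood of \<open>0\<close>, is the inverse of a chart
  centred at \<open>m\<close>. Changes of charts are translations, so each tangent space is identified
  with \<open>'e\<close>, and vector fields are functions \<open>'m \<Rightarrow> 'e\<close>.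
\<close>

definition shift_S1 :: "(real \<times> real) \<times> circle \<Rightarrow> (real \<times> real) \<times> real \<Rightarrow> (real \<times> real) \<times> circle"
  where "shift_S1 m v = (fst m + fst v, rotate_circle (snd m) (snd v))"

definition shift_Aff :: "real \<times> real \<Rightarrow> real \<times> real \<Rightarrow> real \<times> real"
  where "shift_Aff m v = m + v"

definition has_velocity ::
    "('m \<Rightarrow> 'e::euclidean_space \<Rightarrow> 'm) \<Rightarrow> (real \<Rightarrow> 'm) \<Rightarrow> 'e \<Rightarrow> real \<Rightarrow> bool"
  where "has_velocity sh \<gamma> w s \<longleftrightarrow>
    (\<exists>c. c s = 0 \<and> (\<forall>\<^sub>F r in nhds s. \<gamma> r = sh (\<gamma> s) (c r)) \<and>
         (c has_vector_derivative w) (at s))"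

definition locally_finite_set :: "real set \<Rightarrow> bool"
  where "locally_finite_set D \<longleftrightarrow> (\<forall>a b. finite (D \<inter> {a..b}))"

definition piecewise_constant :: "(real \<Rightarrow> real) \<Rightarrow> bool"
  where "piecewise_constant u \<longleftrightarrow>
    (\<exists>D. locally_finite_set D \<and> (\<forall>a b. {a<..<b} \<inter> D = {} \<longrightarrow> u constant_on {a<..<b}))"

definition controls :: "real set \<Rightarrow> (real \<Rightarrow> real) set"
  where "controls \<Omega> = {u. piecewise_constant u \<and> range u \<subseteq> \<Omega>}"

text \<open>
  \<open>is_solution sh f\<^sub>0 f\<^sub>1 u x \<gamma>\<close> says that \<open>\<gamma>\<close> is \<open>s \<mapsto> \<phi>(s, x, u)\<close>. The equation is required off a
  locally finite set because \<open>\<gamma>\<close> need not be differentiable where \<open>u\<close> jumps.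
\<close>

definition is_solution ::
    "('m::topological_space \<Rightarrow> 'e::euclidean_space \<Rightarrow> 'm) \<Rightarrow> ('m \<Rightarrow> 'e) \<Rightarrow> ('m \<Rightarrow> 'e) \<Rightarrow>
     (real \<Rightarrow> real) \<Rightarrow> 'm \<Rightarrow> (real \<Rightarrow> 'm) \<Rightarrow> bool"
  where "is_solution sh f\<^sub>0 f\<^sub>1 u x \<gamma> \<longleftrightarrow>
    \<gamma> 0 = x \<and> continuous_on UNIV \<gamma> \<and>
    (\<exists>D. locally_finite_set D \<and>
      (\<forall>s. s \<notin> D \<longrightarrow> has_velocity sh \<gamma> (f\<^sub>0 (\<gamma> s) + u s *\<^sub>R f\<^sub>1 (\<gamma> s)) s))"

definition positive_orbit ::
    "('m::topological_space \<Rightarrow> 'e::euclidean_space \<Rightarrow> 'm) \<Rightarrow> ('m \<Rightarrow> 'e) \<Rightarrow> ('m \<Rightarrow> 'e) \<Rightarrow>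
     real set \<Rightarrow> 'm \<Rightarrow> 'm set"
  where "positive_orbit sh f\<^sub>0 f\<^sub>1 \<Omega> x =
    {\<gamma> S | S u \<gamma>. S > 0 \<and> u \<in> controls \<Omega> \<and> is_solution sh f\<^sub>0 f\<^sub>1 u x \<gamma>}"

definition pre_control_set ::
    "('m::topological_space \<Rightarrow> 'e::euclidean_space \<Rightarrow> 'm) \<Rightarrow> ('m \<Rightarrow> 'e) \<Rightarrow> ('m \<Rightarrow> 'e) \<Rightarrow>
     real set \<Rightarrow> 'm set \<Rightarrow> bool"
  where "pre_control_set sh f\<^sub>0 f\<^sub>1 \<Omega> D \<longleftrightarrow>
    (\<forall>x\<in>D. \<exists>u\<in>controls \<Omega>. \<exists>\<gamma>. is_solution sh f\<^sub>0 f\<^sub>1 u x \<gamma> \<and> (\<forall>s>0. \<gamma> s \<in> D)) \<and>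
    (\<forall>x\<in>D. D \<subseteq> closure (positive_orbit sh f\<^sub>0 f\<^sub>1 \<Omega> x))"

definition control_set ::
    "('m::topological_space \<Rightarrow> 'e::euclidean_space \<Rightarrow> 'm) \<Rightarrow> ('m \<Rightarrow> 'e) \<Rightarrow> ('m \<Rightarrow> 'e) \<Rightarrow>
     real set \<Rightarrow> 'm set \<Rightarrow> bool"
  where "control_set sh f\<^sub>0 f\<^sub>1 \<Omega> D \<longleftrightarrow>
    pre_control_set sh f\<^sub>0 f\<^sub>1 \<Omega> D \<and>
    (\<forall>D'. pre_control_set sh f\<^sub>0 f\<^sub>1 \<Omega> D' \<longrightarrow> D \<subseteq> D' \<longrightarrow> D' = D)"

text \<open>The bracket and the rank condition are meant for smooth fields \<open>f\<^sub>0\<close>, \<open>f\<^sub>1\<close>.\<close>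

definition lie_bracket ::
    "('m \<Rightarrow> 'e::euclidean_space \<Rightarrow> 'm) \<Rightarrow> ('m \<Rightarrow> 'e) \<Rightarrow> ('m \<Rightarrow> 'e) \<Rightarrow> 'm \<Rightarrow> 'e"
  where "lie_bracket sh f g m =
    frechet_derivative (\<lambda>v. g (sh m v)) (at 0) (f m) -
    frechet_derivative (\<lambda>v. f (sh m v)) (at 0) (g m)"

inductive_set generated_lie_algebra ::
    "('m \<Rightarrow> 'e::euclidean_space \<Rightarrow> 'm) \<Rightarrow> ('m \<Rightarrow> 'e) \<Rightarrow> ('m \<Rightarrow> 'e) \<Rightarrow> ('m \<Rightarrow> 'e) set"
  for sh f\<^sub>0 f\<^sub>1 where
  drift: "f\<^sub>0 \<in> generated_lie_algebra sh f\<^sub>0 f\<^sub>1"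
| control: "f\<^sub>1 \<in> generated_lie_algebra sh f\<^sub>0 f\<^sub>1"
| add: "\<lbrakk>f \<in> generated_lie_algebra sh f\<^sub>0 f\<^sub>1; g \<in> generated_lie_algebra sh f\<^sub>0 f\<^sub>1\<rbrakk>
    \<Longrightarrow> (\<lambda>m. f m + g m) \<in> generated_lie_algebra sh f\<^sub>0 f\<^sub>1"
| scale: "f \<in> generated_lie_algebra sh f\<^sub>0 f\<^sub>1
    \<Longrightarrow> (\<lambda>m. c *\<^sub>R f m) \<in> generated_lie_algebra sh f\<^sub>0 f\<^sub>1"
| bracket: "\<lbrakk>f \<in> generated_lie_algebra sh f\<^sub>0 f\<^sub>1; g \<in> generated_lie_algebra sh f\<^sub>0 f\<^sub>1\<rbrakk>
    \<Longrightarrow> lie_bracket sh f g \<in> generated_lie_algebra sh f\<^sub>0 f\<^sub>1"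

definition LARC ::
    "('m \<Rightarrow> 'e::euclidean_space \<Rightarrow> 'm) \<Rightarrow> ('m \<Rightarrow> 'e) \<Rightarrow> ('m \<Rightarrow> 'e) \<Rightarrow> bool"
  where "LARC sh f\<^sub>0 f\<^sub>1 \<longleftrightarrow> (\<forall>m. span ((\<lambda>f. f m) ` generated_lie_algebra sh f\<^sub>0 f\<^sub>1) = UNIV)"


section \<open>Linear control systems\<close>

definition mat_exp :: "real^'n^'n \<Rightarrow> real^'n^'n"
  where "mat_exp M = (\<Sum>k. (1 / fact k) *\<^sub>R (((**) M) ^^ k) (mat 1))"

definition theta :: "real^2^2"
  where "theta = vector [vector [1, 0], vector [0, 0]]"

definition rho :: "real \<Rightarrow> real^2^2"
  where "rho t = mat_exp (t *\<^sub>R theta)"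

definition Lam :: "real \<Rightarrow> real^2 \<Rightarrow> real^2"
  where "Lam t \<xi> = (LBINT s=0..t. rho s *v \<xi>)"

definition linear_field :: "real^2^2 \<Rightarrow> real^2 \<Rightarrow> real \<times> (real^2) \<Rightarrow> real \<times> (real^2)"
  where "linear_field A \<xi> = (\<lambda>(t, v). (0, A *v v + Lam t \<xi>))"

definition left_invariant_field :: "real \<Rightarrow> real^2 \<Rightarrow> real \<times> (real^2) \<Rightarrow> real \<times> (real^2)"
  where "left_invariant_field \<alpha> \<eta> = (\<lambda>(t, v). (\<alpha>, rho t *v \<eta>))"

text \<open>
  The composition \<open>G(\<theta>) \<rightarrow> Aff(\<real>) \<times> \<real> \<rightarrow> Aff(\<real>) \<times> S\<^sup>1\<close> of the isomorphism with the quotient map,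
  and its differential in translation coordinates, the same at every point.
\<close>

definition proj_S1 :: "real \<times> (real^2) \<Rightarrow> (real \<times> real) \<times> circle"
  where "proj_S1 = (\<lambda>(t, v). ((t, v $ 1), abs_circle (v $ 2)))"

definition dproj_S1 :: "real \<times> (real^2) \<Rightarrow> (real \<times> real) \<times> real"
  where "dproj_S1 = (\<lambda>(t, v). ((t, v $ 1), v $ 2))"

text \<open>
  \<open>F'\<close> is the projection of \<open>F\<close> along \<open>p\<close>, a map with constant differential \<open>dp\<close>. For
  surjective \<open>p\<close> this determines \<open>F'\<close>.
\<close>

definition projects_to :: "('a \<Rightarrow> 'b) \<Rightarrow> ('c \<Rightarrow> 'd) \<Rightarrow> ('a \<Rightarrow> 'c) \<Rightarrow> ('b \<Rightarrow> 'd) \<Rightarrow> bool"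
  where "projects_to p dp F F' \<longleftrightarrow> (\<forall>g. F' (p g) = dp (F g))"


section \<open>Coordinate expressions\<close>

lemma theta_power:
  assumes "k > 0"
  shows "(((**) (t *\<^sub>R theta)) ^^ k) (mat 1) = t ^ k *\<^sub>R theta"
  using assms
proof (induction k)
  case (Suc k)
  have tt: "theta ** theta = theta"
    by (simp add: theta_def vec_eq_iff matrix_matrix_mult_def forall_2 sum_2)
  show ?case
  proof (cases "k = 0")
    case False
    then have "(((**) (t *\<^sub>R theta)) ^^ Suc k) (mat 1) = (t *\<^sub>R theta) ** (t ^ k *\<^sub>R theta)"
      using Suc by simp
    also have "\<dots> = t ^ Suc k *\<^sub>R (theta ** theta)"
      by (simp add: matrix_matrix_mult_def vec_eq_iff forall_2 sum_2 algebra_simps)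
    finally show ?thesis by (simp only: tt)
  qed simp
qed simp

lemma rho_eq: "rho t = vector [vector [exp t, 0], vector [0, 1]]"
proof -
  have e: "(\<lambda>k. (1 / fact k) *\<^sub>R (((**) (t *\<^sub>R theta)) ^^ k) (mat 1)) =
      (\<lambda>k. (t ^ k /\<^sub>R fact k) *\<^sub>R theta + (if k = 0 then mat 1 - theta else 0))"
    by (rule ext) (auto simp: theta_power divide_inverse mult.commute)
  have "(\<lambda>k. (t ^ k /\<^sub>R fact k) *\<^sub>R theta + (if k = 0 then mat 1 - theta else 0))
      sums (exp t *\<^sub>R theta + (mat 1 - theta))"
    by (intro sums_add sums_scaleR_left exp_converges)
       (use sums_single[of 0 "\<lambda>_. mat 1 - theta :: real^2^2"] in simp)
  then have "rho t = exp t *\<^sub>R theta + (mat 1 - theta)"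
    unfolding rho_def mat_exp_def e by (rule sums_unique[symmetric])
  then show ?thesis
    by (simp add: theta_def vec_eq_iff forall_2 mat_def)
qed

lemma Lam_eq: "Lam t \<xi> = vector [(exp t - 1) * \<xi> $ 1, t * \<xi> $ 2]"
proof -
  have r: "rho s *v \<xi> = (exp s * \<xi> $ 1) *\<^sub>R axis 1 1 + (\<xi> $ 2) *\<^sub>R axis 2 1" for s
    by (simp add: rho_eq vec_eq_iff forall_2 matrix_vector_mult_def sum_2 axis_def)
  let ?F = "\<lambda>s. (exp s * \<xi> $ 1) *\<^sub>R axis 1 1 + (s * \<xi> $ 2) *\<^sub>R (axis 2 1 :: real^2)"
  have "Lam t \<xi> = ?F t - ?F 0"
    unfolding Lam_def r zero_ereal_def
  proof (rule interval_integral_FTC_finite)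
    show "continuous_on {min 0 t..max 0 t}
        (\<lambda>s. (exp s * \<xi> $ 1) *\<^sub>R axis 1 1 + (\<xi> $ 2) *\<^sub>R (axis 2 1 :: real^2))"
      by (intro continuous_intros)
  next
    fix x assume "min 0 t \<le> x" "x \<le> max 0 t"
    show "(?F has_vector_derivative
        (exp x * \<xi> $ 1) *\<^sub>R axis 1 1 + (\<xi> $ 2) *\<^sub>R (axis 2 1 :: real^2)) (at x within {min 0 t..max 0 t})"
      by (auto intro!: derivative_eq_intros)
  qed
  then show ?thesis
    by (simp add: vec_eq_iff forall_2 axis_def algebra_simps)
qed

lemma proj_S1_representative: "\<exists>t x y. m = proj_S1 (t, vector [x, y])"
proof -
  obtain t x z where m: "m = ((t, x), z)" by (metis surj_pair)
  obtain y where "z = abs_circle y" by (metis Quotient3_abs_rep[OF Quotient3_circle])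
  then have "m = proj_S1 (t, vector [x, y])" by (simp add: m proj_S1_def)
  then show ?thesis by blast
qed

lemma commuting_matrix_eq:
  assumes "A ** theta = theta ** A" "A *v axis 2 1 = 0"
  shows "A = vector [vector [trace A, 0], vector [0, 0]]"
proof -
  have "(A ** theta) $ 2 $ 1 = (theta ** A) $ 2 $ 1" using assms(1) by (rule arg_cong)
  then have 21: "A $ 2 $ 1 = 0"
    by (simp add: theta_def matrix_matrix_mult_def sum_2)
  have "(A *v axis 2 1) $ 1 = 0" "(A *v axis 2 1) $ 2 = 0" by (simp_all only: assms(2) zero_index)
  then have "A $ 1 $ 2 = 0" "A $ 2 $ 2 = 0"
    by (simp_all add: matrix_vector_mult_def sum_2 axis_def)
  with 21 show ?thesis by (simp add: vec_eq_iff forall_2 trace_def sum_2)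
qed

text \<open>The projections to \<open>Aff(\<real>) \<times> S\<^sup>1\<close> exist and are given by the usual coordinate formulas.\<close>

lemma linear_field_projects_iff:
  assumes "A ** theta = theta ** A" "A *v axis 2 1 = 0"
  shows "projects_to proj_S1 dproj_S1 (linear_field A \<xi>) X \<longleftrightarrow>
    X = (\<lambda>((t, x), z). ((0, trace A * x + (exp t - 1) * \<xi> $ 1), t * \<xi> $ 2))"
    (is "?L \<longleftrightarrow> X = ?X")
proof -
  have A: "A *v v = vector [trace A * v $ 1, 0]" for v
    by (subst commuting_matrix_eq[OF assms])
       (simp add: vec_eq_iff forall_2 matrix_vector_mult_def sum_2)
  have X: "?X (proj_S1 g) = dproj_S1 (linear_field A \<xi> g)" for g
    by (cases g) (simp add: proj_S1_def dproj_S1_def linear_field_def A Lam_eq)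
  show ?thesis
  proof
    assume ?L
    show "X = ?X"
    proof
      fix m
      obtain t x y where m: "m = proj_S1 (t, vector [x, y])" using proj_S1_representative by blast
      have "X m = dproj_S1 (linear_field A \<xi> (t, vector [x, y]))"
        using \<open>?L\<close> unfolding m projects_to_def by (rule spec)
      also have "\<dots> = ?X m" unfolding m by (rule X[symmetric])
      finally show "X m = ?X m" .
    qed
  qed (simp add: projects_to_def X)
qed

lemma left_invariant_field_projects_iff:
  "projects_to proj_S1 dproj_S1 (left_invariant_field \<alpha> \<eta>) Y \<longleftrightarrow>
    Y = (\<lambda>((t, x), z). ((\<alpha>, exp t * \<eta> $ 1), \<eta> $ 2))"
    (is "?L \<longleftrightarrow> Y = ?Y")
proof -
  have Y: "?Y (proj_S1 g) = dproj_S1 (left_invariant_field \<alpha> \<eta> g)" for g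
    by (cases g) (simp add: proj_S1_def dproj_S1_def left_invariant_field_def rho_eq
        matrix_vector_mult_def sum_2)
  show ?thesis
  proof
    assume ?L
    show "Y = ?Y"
    proof
      fix m
      obtain t x y where m: "m = proj_S1 (t, vector [x, y])" using proj_S1_representative by blast
      have "Y m = dproj_S1 (left_invariant_field \<alpha> \<eta> (t, vector [x, y]))"
        using \<open>?L\<close> unfolding m projects_to_def by (rule spec)
      also have "\<dots> = ?Y m" unfolding m by (rule Y[symmetric])
      finally show "Y m = ?Y m" .
    qed
  qed (simp add: projects_to_def Y)
qed

end

theory Submission
  imports Defs
begin

text \<open>
  Write \<open>\<lambda> = tr A\<close> and \<open>v = u \<alpha>\<close>. The rank condition forces \<open>\<alpha>\<close>, \<open>\<xi>\<^sub>2\<close> and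
  \<open>\<kappa> = \<xi>\<^sub>1 + \<lambda> \<eta>\<^sub>1 / \<alpha>\<close> to be nonzero
  (\<open>LARC_affine_exp_nonzero\<close>). With \<open>w = x - (\<eta>\<^sub>1 / \<alpha>) (exp t - 1)\<close> and
  \<open>z = y - (\<eta>\<^sub>2 / \<alpha>) t\<close> the control disappears from all equations but one:
  \<open>t' = v\<close>, \<open>w' = \<lambda> w + \<kappa> (exp t - 1)\<close>, \<open>z' = \<xi>\<^sub>2 t\<close>, where \<open>v\<close> ranges over an interval
  \<open>[vm, vp]\<close> around \<open>0\<close>.

  For \<open>\<lambda> \<noteq> 0\<close> put \<open>q = 1 - (\<lambda> / \<kappa>) w\<close> and \<open>r = q exp (- t)\<close>. Then \<open>q' = \<lambda> (q - exp t)\<close>, and the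
  slope \<open>r\<close> satisfies \<open>r' = (\<lambda> - v) r - \<lambda>\<close>, an equation without \<open>t\<close>. A positive slope is stationary
  for some admissible \<open>v\<close> iff \<open>(\<lambda> - vp) r \<le> \<lambda> \<le> (\<lambda> - vm) r\<close>. The control set in the affine group
  consists of the points whose slope satisfies these inequalities: strictly if \<open>\<lambda> > 0\<close>, when
  positive slopes outside the interval cannot approach it and the set is open, and weakly if
  \<open>\<lambda> < 0\<close>, when positive slopes outside cannot recede from it and the set is closed.

  Nothing larger is possible: outside, \<open>q\<close> or \<open>r\<close> is monotone along every trajectory
  (\<open>barrier_increasing\<close>), which confines a set with mutual approximate reachability to one level of
  this function, so that its interior is empty (\<open>pre_control_set_bounds_pos\<close>, \<open>pre_control_set_bounds_neg\<close>).

  Conversely, for two slopes in the open interval one drives \<open>r\<close> monotonically with an extreme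
  control, and with \<open>v = \<lambda> (1 - 1 / r)\<close> one keeps \<open>r\<close> fixed while \<open>t\<close> drifts in a direction
  chosen by \<open>r < 1\<close> or \<open>r > 1\<close>; so all pairs \<open>(t, r)\<close> are joined (\<open>cone_reach_affine\<close>). The circle
  coordinate comes for free: at \<open>t = 1\<close>, \<open>r = 1\<close> the control \<open>0\<close> leaves \<open>(t, r)\<close> fixed while \<open>z\<close>
  rotates with speed \<open>\<xi>\<^sub>2\<close>, and waiting there adjusts the angle (\<open>cone_reach_slopes\<close>). This is
  where compactness of the fibre enters.

  For \<open>\<lambda> = 0\<close> one waits at \<open>t = 1\<close> and at \<open>t = - 1\<close> on the way. The waiting times enter \<open>w\<close>
  and \<open>z\<close> through independent linear forms, and adding a large multiple of \<open>2 \<pi>\<close> to the target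
  angle makes both times positive (\<open>reach_trace_zero\<close>); so everything is reachable from
  everywhere.

  Only the three-dimensional system needs explicit trajectories, since sets with the first two
  properties of a control set project to such sets (\<open>pre_control_set_fst\<close>), and only the affine
  group needs monotone functions (\<open>control_sets_eq\<close>).
\<close>

section \<open>Orbits and control sets of general systems\<close>

lemma locally_finite_set_insert:
  "locally_finite_set D \<Longrightarrow> locally_finite_set (insert s D)"
  by (auto simp: locally_finite_set_def Int_insert_left)

lemma locally_finite_set_Un:
  "\<lbrakk>locally_finite_set D; locally_finite_set E\<rbrakk> \<Longrightarrow> locally_finite_set (D \<union> E)"
  by (auto simp: locally_finite_set_def Int_Un_distrib2)

lemma locally_finite_set_translation:
  assumes "locally_finite_set D"
  shows "locally_finite_set ((+) s ` D)"
  unfolding locally_finite_set_def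
proof (intro allI)
  fix a b
  have "(+) s ` D \<inter> {a..b} \<subseteq> (+) s ` (D \<inter> {a - s..b - s})" by auto
  moreover have "finite ((+) s ` (D \<inter> {a - s..b - s}))"
    using assms unfolding locally_finite_set_def by blast
  ultimately show "finite ((+) s ` D \<inter> {a..b})" by (rule finite_subset)
qed

lemma locally_finite_set_empty: "locally_finite_set {}"
  by (simp add: locally_finite_set_def)

lemma const_in_controls: "c \<in> \<Omega> \<Longrightarrow> (\<lambda>_. c) \<in> controls \<Omega>"
  using locally_finite_set_empty
  by (auto simp: controls_def piecewise_constant_def constant_on_def)

lemma piecewise_constant_concat:
  assumes "piecewise_constant u" "piecewise_constant v"
  shows "piecewise_constant (\<lambda>s. if s \<le> S then u s else v (s - S))"
proof -
  obtain D where D: "locally_finite_set D" "\<And>a b. {a<..<b} \<inter> D = {} \<Longrightarrow> u constant_on {a<..<b}"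
    using assms(1) unfolding piecewise_constant_def by blast
  obtain E where E: "locally_finite_set E" "\<And>a b. {a<..<b} \<inter> E = {} \<Longrightarrow> v constant_on {a<..<b}"
    using assms(2) unfolding piecewise_constant_def by blast
  let ?w = "\<lambda>s. if s \<le> S then u s else v (s - S)"
  let ?F = "insert S (D \<union> (+) S ` E)"
  have "?w constant_on {a<..<b}" if disj: "{a<..<b} \<inter> ?F = {}" for a b
  proof (cases "b \<le> S")
    case True
    have "u constant_on {a<..<b}" using disj by (intro D) auto
    then show ?thesis using True by (auto simp: constant_on_def)
  next
    case False
    then have S: "S \<le> a \<or> {a<..<b} = {}" using disj by force
    have "{a - S<..<b - S} \<inter> E = {}"
    proof -
      have "S + e \<notin> {a<..<b}" if "e \<in> E" for e using disj that by blast
      then show ?thesis by fastforce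
    qed
    then obtain c where "\<And>s. s \<in> {a - S<..<b - S} \<Longrightarrow> v s = c"
      using E(2) unfolding constant_on_def by blast
    then have "?w s = c" if "s \<in> {a<..<b}" for s using S that by auto
    then show ?thesis unfolding constant_on_def by blast
  qed
  moreover have "locally_finite_set ?F"
    using D(1) E(1) by (intro locally_finite_set_insert locally_finite_set_Un locally_finite_set_translation)
  ultimately show ?thesis unfolding piecewise_constant_def by blast
qed

lemma has_velocity_transform:
  assumes "has_velocity sh \<gamma> w s" "\<forall>\<^sub>F r in nhds s. \<gamma>' r = \<gamma> r"
  shows "has_velocity sh \<gamma>' w s"
proof -
  from assms(1) obtain c where c: "c s = 0" "\<forall>\<^sub>F r in nhds s. \<gamma> r = sh (\<gamma> s) (c r)"
    "(c has_vector_derivative w) (at s)" unfolding has_velocity_def by blast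
  have "\<gamma>' s = \<gamma> s" using assms(2) by (rule eventually_nhds_x_imp_x)
  moreover have "\<forall>\<^sub>F r in nhds s. \<gamma>' r = sh (\<gamma> s) (c r)"
    using c(2) assms(2) by eventually_elim simp
  ultimately show ?thesis using c unfolding has_velocity_def by auto
qed

lemma has_velocity_time_shift:
  assumes "has_velocity sh \<gamma> w (s - S)"
  shows "has_velocity sh (\<lambda>r. \<gamma> (r - S)) w s"
proof -
  from assms obtain c where c: "c (s - S) = 0" "\<forall>\<^sub>F r in nhds (s - S). \<gamma> r = sh (\<gamma> (s - S)) (c r)"
    "(c has_vector_derivative w) (at (s - S))" unfolding has_velocity_def by blast
  have lim: "filterlim (\<lambda>r. r - S) (nhds (s - S)) (nhds s)"
    by (intro tendsto_intros filterlim_ident)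
  have "\<forall>\<^sub>F r in nhds s. \<gamma> (r - S) = sh (\<gamma> (s - S)) (c (r - S))"
    using eventually_compose_filterlim[OF c(2) lim] .
  moreover have "((\<lambda>r. c (r - S)) has_vector_derivative w) (at s)"
  proof -
    have "((\<lambda>r. r - S) has_vector_derivative 1) (at s)"
      by (auto intro!: derivative_eq_intros)
    from vector_diff_chain_at[OF this c(3)] show ?thesis by (simp add: o_def)
  qed
  ultimately show ?thesis using c(1) unfolding has_velocity_def by (intro exI[of _ "\<lambda>r. c (r - S)"]) auto
qed

text \<open>Two trajectories can be concatenated because the exceptional locally finite set absorbs the
  corner at the switching time.\<close>

lemma positive_orbit_trans:
  assumes "y \<in> positive_orbit sh f\<^sub>0 f\<^sub>1 \<Omega> x" "z \<in> positive_orbit sh f\<^sub>0 f\<^sub>1 \<Omega> y"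
  shows "z \<in> positive_orbit sh f\<^sub>0 f\<^sub>1 \<Omega> x"
proof -
  obtain S u \<gamma> where 1: "y = \<gamma> S" "S > 0" "u \<in> controls \<Omega>" "is_solution sh f\<^sub>0 f\<^sub>1 u x \<gamma>"
    using assms(1) unfolding positive_orbit_def by blast
  obtain S' u' \<gamma>' where 2: "z = \<gamma>' S'" "S' > 0" "u' \<in> controls \<Omega>" "is_solution sh f\<^sub>0 f\<^sub>1 u' y \<gamma>'"
    using assms(2) unfolding positive_orbit_def by blast
  define w where "w = (\<lambda>s. if s \<le> S then u s else u' (s - S))"
  define \<delta> where "\<delta> = (\<lambda>s. if s \<le> S then \<gamma> s else \<gamma>' (s - S))"
  have w: "w \<in> controls \<Omega>"
    using 1(3) 2(3) piecewise_constant_concat[of u u' S] by (auto simp: controls_def w_def)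
  obtain D where D: "locally_finite_set D"
    "\<And>s. s \<notin> D \<Longrightarrow> has_velocity sh \<gamma> (f\<^sub>0 (\<gamma> s) + u s *\<^sub>R f\<^sub>1 (\<gamma> s)) s"
    using 1(4) unfolding is_solution_def by blast
  obtain E where E: "locally_finite_set E"
    "\<And>s. s \<notin> E \<Longrightarrow> has_velocity sh \<gamma>' (f\<^sub>0 (\<gamma>' s) + u' s *\<^sub>R f\<^sub>1 (\<gamma>' s)) s"
    using 2(4) unfolding is_solution_def by blast
  have cont: "continuous_on UNIV \<gamma>" "continuous_on UNIV \<gamma>'" and start: "\<gamma> 0 = x" "\<gamma>' 0 = y"
    using 1(4) 2(4) by (auto simp: is_solution_def)
  let ?F = "insert S (D \<union> (+) S ` E)"
  have vel: "has_velocity sh \<delta> (f\<^sub>0 (\<delta> s) + w s *\<^sub>R f\<^sub>1 (\<delta> s)) s" if s: "s \<notin> ?F" for s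
  proof (cases "s < S")
    case True
    then have "has_velocity sh \<gamma> (f\<^sub>0 (\<delta> s) + w s *\<^sub>R f\<^sub>1 (\<delta> s)) s"
      using D(2)[of s] s by (simp add: \<delta>_def w_def)
    moreover have "\<forall>\<^sub>F r in nhds s. r \<in> {..<S}"
      using True by (intro eventually_nhds_in_open) auto
    then have "\<forall>\<^sub>F r in nhds s. \<delta> r = \<gamma> r"
      by eventually_elim (simp add: \<delta>_def)
    ultimately show ?thesis by (rule has_velocity_transform)
  next
    case False
    with s have "S < s" by auto
    have "s - S \<notin> E" using s by (auto simp: image_iff)
    then have "has_velocity sh \<gamma>' (f\<^sub>0 (\<delta> s) + w s *\<^sub>R f\<^sub>1 (\<delta> s)) (s - S)"
      using E(2)[of "s - S"] \<open>S < s\<close> by (simp add: \<delta>_def w_def)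
    then have "has_velocity sh (\<lambda>r. \<gamma>' (r - S)) (f\<^sub>0 (\<delta> s) + w s *\<^sub>R f\<^sub>1 (\<delta> s)) s"
      by (rule has_velocity_time_shift)
    moreover have "\<forall>\<^sub>F r in nhds s. r \<in> {S<..}"
      using \<open>S < s\<close> by (intro eventually_nhds_in_open) auto
    then have "\<forall>\<^sub>F r in nhds s. \<delta> r = \<gamma>' (r - S)"
      by eventually_elim (simp add: \<delta>_def)
    ultimately show ?thesis by (rule has_velocity_transform)
  qed
  have "continuous_on ({..S} \<union> {S..}) \<delta>"
    unfolding \<delta>_def
  proof (rule continuous_on_If)
    show "continuous_on {..S} \<gamma>" using cont(1) continuous_on_subset by blast
    have "continuous_on UNIV (\<lambda>s. \<gamma>' (s - S))"
      by (rule continuous_on_compose2[OF cont(2)]) (auto intro!: continuous_intros)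
    then show "continuous_on {S..} (\<lambda>s. \<gamma>' (s - S))" using continuous_on_subset by blast
  qed (use start 1(1) in auto)
  moreover have "{..S} \<union> {S..} = UNIV" by auto
  ultimately have "continuous_on UNIV \<delta>" by simp
  moreover have "locally_finite_set ?F"
    using D(1) E(1) by (intro locally_finite_set_insert locally_finite_set_Un locally_finite_set_translation)
  moreover have "\<delta> 0 = x" using 1(2) start by (simp add: \<delta>_def)
  ultimately have "is_solution sh f\<^sub>0 f\<^sub>1 w x \<delta>"
    unfolding is_solution_def using vel by blast
  moreover have "\<delta> (S + S') = z" "S + S' > 0" using 1 2 by (auto simp: \<delta>_def)
  ultimately show ?thesis unfolding positive_orbit_def using w by blast
qed

text \<open>The closed positively invariant sets bound control sets from outside; they are used as sublevel
  and superlevel sets of functions that are monotone along trajectories.\<close>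

lemma pre_control_set_subset_invariant:
  assumes "pre_control_set sh f\<^sub>0 f\<^sub>1 \<Omega> D" "closed P"
    and "\<And>p. p \<in> P \<Longrightarrow> positive_orbit sh f\<^sub>0 f\<^sub>1 \<Omega> p \<subseteq> P"
    and "d \<in> D" "d \<in> P"
  shows "D \<subseteq> P"
  using assms closure_minimal[of "positive_orbit sh f\<^sub>0 f\<^sub>1 \<Omega> d" P]
  unfolding pre_control_set_def by blast

text \<open>Maximality and uniqueness both reduce to a comparison with \<open>C\<close>: a set that contains \<open>C\<close> has
  nonempty interior as well, so the last hypothesis applies to it.\<close>

lemma unique_control_set_with_interior:
  assumes "pre_control_set sh f\<^sub>0 f\<^sub>1 \<Omega> C" "interior C \<noteq> {}"
    and "\<And>D. \<lbrakk>pre_control_set sh f\<^sub>0 f\<^sub>1 \<Omega> D; interior D \<noteq> {}\<rbrakk> \<Longrightarrow> D \<subseteq> C"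
  shows "control_set sh f\<^sub>0 f\<^sub>1 \<Omega> D \<and> interior D \<noteq> {} \<longleftrightarrow> D = C"
proof
  assume "control_set sh f\<^sub>0 f\<^sub>1 \<Omega> D \<and> interior D \<noteq> {}"
  then show "D = C" using assms unfolding control_set_def by blast
next
  assume "D = C"
  moreover have "D' = C" if "pre_control_set sh f\<^sub>0 f\<^sub>1 \<Omega> D'" "C \<subseteq> D'" for D'
    using assms(2,3) that interior_mono[of C D'] by blast
  ultimately show "control_set sh f\<^sub>0 f\<^sub>1 \<Omega> D \<and> interior D \<noteq> {}"
    using assms(1,2) unfolding control_set_def by blast
qed

section \<open>Projection to the affine group\<close>

lemma has_velocity_shift_Aff_iff:
  "has_velocity shift_Aff \<gamma> w s \<longleftrightarrow> (\<gamma> has_vector_derivative w) (at s)"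
proof
  assume "has_velocity shift_Aff \<gamma> w s"
  then obtain c where c: "\<forall>\<^sub>F r in nhds s. \<gamma> r = \<gamma> s + c r" "(c has_vector_derivative w) (at s)"
    unfolding has_velocity_def shift_Aff_def by blast
  have d: "((\<lambda>r. \<gamma> s + c r) has_vector_derivative w) (at s)"
    using c(2) by (auto intro!: derivative_eq_intros)
  from c(1) obtain U where "open U" "s \<in> U" "\<And>r. r \<in> U \<Longrightarrow> \<gamma> s + c r = \<gamma> r"
    unfolding eventually_nhds by metis
  with d show "(\<gamma> has_vector_derivative w) (at s)"
    by (rule has_vector_derivative_transform_within_open)
next
  assume "(\<gamma> has_vector_derivative w) (at s)"
  then have "((\<lambda>r. \<gamma> r - \<gamma> s) has_vector_derivative w) (at s)"
    by (auto intro!: derivative_eq_intros)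
  then show "has_velocity shift_Aff \<gamma> w s"
    unfolding has_velocity_def shift_Aff_def by (intro exI[of _ "\<lambda>r. \<gamma> r - \<gamma> s"]) auto
qed

lemma has_velocity_fst:
  assumes "has_velocity shift_S1 \<gamma> w s"
  shows "has_velocity shift_Aff (\<lambda>r. fst (\<gamma> r)) (fst w) s"
proof -
  obtain c where c: "c s = 0" "\<forall>\<^sub>F r in nhds s. \<gamma> r = shift_S1 (\<gamma> s) (c r)"
    "(c has_vector_derivative w) (at s)" using assms unfolding has_velocity_def by blast
  have "((\<lambda>r. fst (c r)) has_vector_derivative fst w) (at s)"
    using c(3) unfolding has_vector_derivative_def by (auto dest: has_derivative_fst)
  moreover have "\<forall>\<^sub>F r in nhds s. fst (\<gamma> r) = shift_Aff (fst (\<gamma> s)) (fst (c r))"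
    using c(2) by eventually_elim (metis fst_conv shift_Aff_def shift_S1_def)
  ultimately show ?thesis unfolding has_velocity_def using c(1)
    by (intro exI[of _ "\<lambda>r. fst (c r)"]) auto
qed

lemma is_solution_fst:
  assumes "is_solution shift_S1 X Y u m \<gamma>" "projects_to fst fst X X'" "projects_to fst fst Y Y'"
  shows "is_solution shift_Aff X' Y' u (fst m) (\<lambda>s. fst (\<gamma> s))"
proof -
  obtain D where D: "locally_finite_set D"
    "\<And>s. s \<notin> D \<Longrightarrow> has_velocity shift_S1 \<gamma> (X (\<gamma> s) + u s *\<^sub>R Y (\<gamma> s)) s"
    using assms(1) unfolding is_solution_def by blast
  have "has_velocity shift_Aff (\<lambda>s. fst (\<gamma> s)) (X' (fst (\<gamma> s)) + u s *\<^sub>R Y' (fst (\<gamma> s))) s"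
    if "s \<notin> D" for s
    using has_velocity_fst[OF D(2)[OF that]] assms(2,3)
    by (simp add: projects_to_def del: split_paired_All)
  moreover have "continuous_on UNIV (\<lambda>s. fst (\<gamma> s))"
    using assms(1) unfolding is_solution_def by (intro continuous_on_fst) auto
  ultimately show ?thesis using assms(1) D(1) unfolding is_solution_def by blast
qed

text \<open>Trajectories project to trajectories, and continuity carries the closure of an orbit into the
  closure of the projected orbit.\<close>

lemma pre_control_set_fst:
  assumes "pre_control_set shift_S1 X Y \<Omega> D" "projects_to fst fst X X'" "projects_to fst fst Y Y'"
  shows "pre_control_set shift_Aff X' Y' \<Omega> (fst ` D)"
  unfolding pre_control_set_def
proof (intro conjI ballI)
  fix x assume "x \<in> fst ` D"
  then obtain m where m: "m \<in> D" "x = fst m" by blast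
  then obtain u \<gamma> where "u \<in> controls \<Omega>" "is_solution shift_S1 X Y u m \<gamma>" "\<forall>s>0. \<gamma> s \<in> D"
    using assms(1) unfolding pre_control_set_def by blast
  then show "\<exists>u\<in>controls \<Omega>. \<exists>\<gamma>. is_solution shift_Aff X' Y' u x \<gamma> \<and> (\<forall>s>0. \<gamma> s \<in> fst ` D)"
    using is_solution_fst[OF _ assms(2,3)] m(2) by blast
  let ?O = "positive_orbit shift_S1 X Y \<Omega> m"
  have "fst ` ?O \<subseteq> positive_orbit shift_Aff X' Y' \<Omega> x"
  proof
    fix p assume "p \<in> fst ` ?O"
    then obtain S v \<delta> where "p = fst (\<delta> S)" "S > 0" "v \<in> controls \<Omega>" "is_solution shift_S1 X Y v m \<delta>"
      unfolding positive_orbit_def by blast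
    with is_solution_fst[OF this(4) assms(2,3)] show "p \<in> positive_orbit shift_Aff X' Y' \<Omega> x"
      unfolding positive_orbit_def m(2)
      by (intro CollectI exI[of _ S] exI[of _ v] exI[of _ "\<lambda>s. fst (\<delta> s)"]) auto
  qed
  moreover have "fst ` closure ?O \<subseteq> closure (fst ` ?O)"
    by (rule image_closure_subset) (auto intro: continuous_on_fst closure_subset[THEN subsetD])
  moreover have "D \<subseteq> closure ?O" using assms(1) m(1) unfolding pre_control_set_def by blast
  ultimately show "fst ` D \<subseteq> closure (positive_orbit shift_Aff X' Y' \<Omega> x)"
    using closure_mono by blast
qed

lemma interior_fst_image:
  fixes D :: "('a::topological_space \<times> 'b::topological_space) set"
  assumes "interior D \<noteq> {}"
  shows "interior (fst ` D) \<noteq> {}"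
proof -
  obtain m where "m \<in> interior D" using assms by blast
  then obtain U V where UV: "open U" "open V" "m \<in> U \<times> V" "U \<times> V \<subseteq> interior D"
    using open_prod_elim[of "interior D" m] by auto
  have "U \<subseteq> fst ` D"
    using UV(3,4) interior_subset[of D] by (force simp: image_iff)
  then have "U \<subseteq> interior (fst ` D)" using UV(1) by (rule interior_maximal)
  then show ?thesis using UV(3) by auto
qed


section \<open>The rank condition\<close>

text \<open>A six-dimensional Lie algebra of fields that contains the drift and the control field. Working
  inside it makes every element of the generated Lie algebra explicitly differentiable, which the
  bracket presupposes.\<close>

definition affine_exp_field ::
    "real \<Rightarrow> real \<Rightarrow> real \<Rightarrow> real \<Rightarrow> real \<Rightarrow> real \<Rightarrow> (real \<times> real) \<times> circle \<Rightarrow> (real \<times> real) \<times> real"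
  where "affine_exp_field a b c d p e = (\<lambda>((t, x), z). ((a, b * x + c * exp t + d), p * t + e))"

lemma lie_bracket_affine_exp_field:
  "lie_bracket shift_S1 (affine_exp_field a b c d p e) (affine_exp_field a' b' c' d' p' e') =
   affine_exp_field 0 0 (b' * c - b * c' + c' * a - c * a') (b' * d - b * d') 0 (p' * a - p * a')"
proof
  fix m :: "(real \<times> real) \<times> circle"
  obtain t x z where m: "m = ((t, x), z)" by (metis surj_pair)
  have D: "frechet_derivative (\<lambda>v. affine_exp_field a b c d p e (shift_S1 m v)) (at 0) =
      (\<lambda>v. ((0, b * snd (fst v) + c * (exp t * fst (fst v))), p * fst (fst v)))" for a b c d p e
  proof (rule frechet_derivative_at[symmetric])
    have eq: "(\<lambda>v. affine_exp_field a b c d p e (shift_S1 m v)) =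
      (\<lambda>v. ((a, b * (x + snd (fst v)) + c * exp (t + fst (fst v)) + d), p * (t + fst (fst v)) + e))"
      by (simp add: fun_eq_iff m shift_S1_def affine_exp_field_def)
    show "((\<lambda>v. affine_exp_field a b c d p e (shift_S1 m v)) has_derivative
      (\<lambda>v. ((0, b * snd (fst v) + c * (exp t * fst (fst v))), p * fst (fst v)))) (at 0)"
      unfolding eq by (auto intro!: derivative_eq_intros simp: fun_eq_iff algebra_simps)
  qed
  show "lie_bracket shift_S1 (affine_exp_field a b c d p e) (affine_exp_field a' b' c' d' p' e') m =
      affine_exp_field 0 0 (b' * c - b * c' + c' * a - c * a') (b' * d - b * d') 0 (p' * a - p * a') m"
    unfolding lie_bracket_def D by (simp add: affine_exp_field_def m algebra_simps)
qed

text \<open>In each of the three degenerate cases the coefficients satisfy linear relations that survive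
  brackets. They say that some covector annihilates the whole generated Lie algebra at the origin.
  The relation \<open>\<alpha> c = h1 (a - b)\<close> is the extra information that makes the one for \<open>c + d\<close>
  inductive.\<close>

lemma generated_lie_algebra_affine_exp:
  assumes "f \<in> generated_lie_algebra shift_S1
      (affine_exp_field 0 l x1 (- x1) x2 0) (affine_exp_field \<alpha> 0 h1 0 0 h2)"
  shows "\<exists>a b c d p e. f = affine_exp_field a b c d p e \<and> (\<alpha> = 0 \<longrightarrow> a = 0) \<and>
    (x2 = 0 \<longrightarrow> p = 0 \<and> \<alpha> * e = h2 * a) \<and>
    (\<alpha> * x1 + l * h1 = 0 \<longrightarrow> \<alpha> * c = h1 * (a - b) \<and> \<alpha> * (c + d) = h1 * a)"
  using assms
proof induction
  case drift
  show ?case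
    by (rule exI[of _ 0], rule exI[of _ l], rule exI[of _ x1], rule exI[of _ "- x1"],
        rule exI[of _ x2], rule exI[of _ 0]) (auto simp: algebra_simps)
next
  case control
  show ?case
    by (rule exI[of _ \<alpha>], rule exI[of _ 0], rule exI[of _ h1], rule exI[of _ 0],
        rule exI[of _ 0], rule exI[of _ h2]) (auto simp: algebra_simps)
next
  case (add f g)
  from add.IH(1) obtain a b c d p e where f: "f = affine_exp_field a b c d p e" "\<alpha> = 0 \<longrightarrow> a = 0"
    "x2 = 0 \<longrightarrow> p = 0 \<and> \<alpha> * e = h2 * a"
    "\<alpha> * x1 + l * h1 = 0 \<longrightarrow> \<alpha> * c = h1 * (a - b) \<and> \<alpha> * (c + d) = h1 * a" by blast
  from add.IH(2) obtain a' b' c' d' p' e' where g: "g = affine_exp_field a' b' c' d' p' e'" "\<alpha> = 0 \<longrightarrow> a' = 0"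
    "x2 = 0 \<longrightarrow> p' = 0 \<and> \<alpha> * e' = h2 * a'"
    "\<alpha> * x1 + l * h1 = 0 \<longrightarrow> \<alpha> * c' = h1 * (a' - b') \<and> \<alpha> * (c' + d') = h1 * a'" by blast
  have "(\<lambda>m. f m + g m) = affine_exp_field (a + a') (b + b') (c + c') (d + d') (p + p') (e + e')"
    by (auto simp: f(1) g(1) affine_exp_field_def algebra_simps)
  moreover have "x2 = 0 \<longrightarrow> \<alpha> * (e + e') = h2 * (a + a')" using f(3) g(3) by (simp add: distrib_left)
  moreover have "\<alpha> * x1 + l * h1 = 0 \<longrightarrow> \<alpha> * (c + c') = h1 * ((a + a') - (b + b')) \<and>
      \<alpha> * ((c + c') + (d + d')) = h1 * (a + a')"
  proof
    assume "\<alpha> * x1 + l * h1 = 0"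
    then have 1: "\<alpha> * c = h1 * (a - b)" "\<alpha> * c' = h1 * (a' - b')"
        "\<alpha> * (c + d) = h1 * a" "\<alpha> * (c' + d') = h1 * a'" using f(4) g(4) by auto
    have "\<alpha> * (c + c') = \<alpha> * c + \<alpha> * c'" "\<alpha> * ((c + c') + (d + d')) = \<alpha> * (c + d) + \<alpha> * (c' + d')"
      by (simp_all only: distrib_left add_ac)
    then show "\<alpha> * (c + c') = h1 * ((a + a') - (b + b')) \<and>
        \<alpha> * ((c + c') + (d + d')) = h1 * (a + a')"
      unfolding 1 by (simp add: algebra_simps)
  qed
  moreover have "\<alpha> = 0 \<longrightarrow> a + a' = 0" "x2 = 0 \<longrightarrow> p + p' = 0" using f(2,3) g(2,3) by auto
  ultimately show ?case by blast
next
  case (scale f k)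
  from scale.IH obtain a b c d p e where f: "f = affine_exp_field a b c d p e" "\<alpha> = 0 \<longrightarrow> a = 0"
    "x2 = 0 \<longrightarrow> p = 0 \<and> \<alpha> * e = h2 * a"
    "\<alpha> * x1 + l * h1 = 0 \<longrightarrow> \<alpha> * c = h1 * (a - b) \<and> \<alpha> * (c + d) = h1 * a" by blast
  have "(\<lambda>m. k *\<^sub>R f m) = affine_exp_field (k * a) (k * b) (k * c) (k * d) (k * p) (k * e)"
    by (auto simp: f(1) affine_exp_field_def algebra_simps)
  moreover have "x2 = 0 \<longrightarrow> \<alpha> * (k * e) = h2 * (k * a)" using f(3) by (metis mult.left_commute)
  moreover have "\<alpha> * x1 + l * h1 = 0 \<longrightarrow> \<alpha> * (k * c) = h1 * (k * a - k * b) \<and> \<alpha> * (k * c + k * d) = h1 * (k * a)"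
    using f(4) by (metis mult.left_commute right_diff_distrib distrib_left)
  moreover have "\<alpha> = 0 \<longrightarrow> k * a = 0" "x2 = 0 \<longrightarrow> k * p = 0" using f(2,3) by auto
  ultimately show ?case by blast
next
  case (bracket f g)
  from bracket.IH(1) obtain a b c d p e where f: "f = affine_exp_field a b c d p e" "\<alpha> = 0 \<longrightarrow> a = 0"
    "x2 = 0 \<longrightarrow> p = 0 \<and> \<alpha> * e = h2 * a"
    "\<alpha> * x1 + l * h1 = 0 \<longrightarrow> \<alpha> * c = h1 * (a - b) \<and> \<alpha> * (c + d) = h1 * a" by blast
  from bracket.IH(2) obtain a' b' c' d' p' e' where g: "g = affine_exp_field a' b' c' d' p' e'" "\<alpha> = 0 \<longrightarrow> a' = 0"
    "x2 = 0 \<longrightarrow> p' = 0 \<and> \<alpha> * e' = h2 * a'"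
    "\<alpha> * x1 + l * h1 = 0 \<longrightarrow> \<alpha> * c' = h1 * (a' - b') \<and> \<alpha> * (c' + d') = h1 * a'" by blast
  let ?c = "b' * c - b * c' + c' * a - c * a'" and ?d = "b' * d - b * d'"
  have "\<alpha> * ?c = 0 \<and> \<alpha> * (?c + ?d) = 0" if "\<alpha> * x1 + l * h1 = 0"
  proof -
    have 1: "\<alpha> * c = h1 * (a - b)" "\<alpha> * c' = h1 * (a' - b')"
        "\<alpha> * (c + d) = h1 * a" "\<alpha> * (c' + d') = h1 * a'" using f(4) g(4) that by auto
    have "\<alpha> * ?c = b' * (\<alpha> * c) - b * (\<alpha> * c') + (\<alpha> * c') * a - (\<alpha> * c) * a'"
      by (simp add: algebra_simps)
    also have "\<dots> = 0" unfolding 1 by (simp add: algebra_simps)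
    finally have z: "\<alpha> * ?c = 0" .
    have "\<alpha> * (?c + ?d) = b' * (\<alpha> * (c + d)) - b * (\<alpha> * (c' + d')) + (\<alpha> * c') * a - (\<alpha> * c) * a'"
      by (simp add: algebra_simps)
    also have "\<dots> = 0" unfolding 1 by (simp add: algebra_simps)
    finally show ?thesis using z by simp
  qed
  moreover have "x2 = 0 \<longrightarrow> \<alpha> * (p' * a - p * a') = 0" using f(3) g(3) by simp
  moreover have "lie_bracket shift_S1 f g = affine_exp_field 0 0 ?c ?d 0 (p' * a - p * a')"
    unfolding f(1) g(1) by (rule lie_bracket_affine_exp_field)
  ultimately show ?case
    by (intro exI[of _ 0] exI[of _ ?c] exI[of _ ?d] exI[of _ "p' * a - p * a'"]) simp
qed

text \<open>If one of the three quantities vanishes, all fields of the Lie algebra at the origin lie in a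
  hyperplane, the kernel of \<open>dt\<close>, of \<open>\<alpha> dy - h2 dt\<close> or of \<open>\<alpha> dx - h1 dt\<close> respectively.\<close>

lemma LARC_affine_exp_nonzero:
  assumes "LARC shift_S1 (affine_exp_field 0 l x1 (- x1) x2 0) (affine_exp_field \<alpha> 0 h1 0 0 h2)"
  shows "\<alpha> \<noteq> 0" "x2 \<noteq> 0" "\<alpha> * x1 + l * h1 \<noteq> 0"
proof -
  let ?G = "generated_lie_algebra shift_S1 (affine_exp_field 0 l x1 (- x1) x2 0) (affine_exp_field \<alpha> 0 h1 0 0 h2)"
  let ?m = "((0, 0), abs_circle 0)"
  have no: False
    if lin: "linear L" and w: "L w \<noteq> 0" and ker: "\<And>f. f \<in> ?G \<Longrightarrow> L (f ?m) = 0" for L :: "_ \<Rightarrow> real" and w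
  proof -
    have "subspace {v. L v = 0}" using lin by (rule linear_subspace_kernel)
    then have "span ((\<lambda>f. f ?m) ` ?G) \<subseteq> {v. L v = 0}" using ker by (intro span_minimal) auto
    then have "UNIV \<subseteq> {v. L v = 0}" using assms unfolding LARC_def by auto
    then show False using w by auto
  qed
  show a: "\<alpha> \<noteq> 0"
  proof
    assume "\<alpha> = 0"
    show False
    proof (rule no[of "\<lambda>v. fst (fst v)" "((1, 0), 0)"])
      show "linear (\<lambda>v::(real \<times> real) \<times> real. fst (fst v))" by (intro linearI) auto
      fix f assume "f \<in> ?G"
      from generated_lie_algebra_affine_exp[OF this] show "fst (fst (f ?m)) = 0"
        using \<open>\<alpha> = 0\<close> by (auto simp: affine_exp_field_def)
    qed simp
  qed
  show "x2 \<noteq> 0"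
  proof
    assume "x2 = 0"
    show False
    proof (rule no[of "\<lambda>v. \<alpha> * snd v - h2 * fst (fst v)" "((0, 0), 1)"])
      show "linear (\<lambda>v::(real \<times> real) \<times> real. \<alpha> * snd v - h2 * fst (fst v))"
        by (intro linearI) (auto simp: algebra_simps)
      fix f assume "f \<in> ?G"
      from generated_lie_algebra_affine_exp[OF this] show "\<alpha> * snd (f ?m) - h2 * fst (fst (f ?m)) = 0"
        using \<open>x2 = 0\<close> by (auto simp: affine_exp_field_def)
    qed (simp add: a)
  qed
  show "\<alpha> * x1 + l * h1 \<noteq> 0"
  proof
    assume 0: "\<alpha> * x1 + l * h1 = 0"
    show False
    proof (rule no[of "\<lambda>v. \<alpha> * snd (fst v) - h1 * fst (fst v)" "((0, 1), 0)"])
      show "linear (\<lambda>v::(real \<times> real) \<times> real. \<alpha> * snd (fst v) - h1 * fst (fst v))"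
        by (intro linearI) (auto simp: algebra_simps)
      fix f assume "f \<in> ?G"
      from generated_lie_algebra_affine_exp[OF this] show "\<alpha> * snd (fst (f ?m)) - h1 * fst (fst (f ?m)) = 0"
        using 0 by (auto simp: affine_exp_field_def)
    qed (simp add: a)
  qed
qed


section \<open>The system in adapted coordinates\<close>

text \<open>The parameters are \<open>l = tr A\<close>, \<open>\<beta> = \<eta>\<^sub>1 / \<alpha>\<close>, \<open>\<kappa> = \<xi>\<^sub>1 + l \<beta>\<close>, \<open>\<omega> = \<xi>\<^sub>2\<close> and \<open>\<delta> = \<eta>\<^sub>2 / \<alpha>\<close>. The
  first assumption is what the rank condition yields.\<close>

locale affine_circle_system =
  fixes l \<kappa> \<beta> \<omega> \<delta> \<alpha> um up :: real
  assumes nonzero: "\<kappa> \<noteq> 0" "\<omega> \<noteq> 0" "\<alpha> \<noteq> 0"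
    and range: "um < 0" "0 < up"
begin

definition "X = (\<lambda>((t, x), z::circle). ((0::real, l * x + (exp t - 1) * (\<kappa> - l * \<beta>)), t * \<omega>))"
definition "Y = (\<lambda>((t, x::real), z::circle). ((\<alpha>, exp t * (\<alpha> * \<beta>)), \<alpha> * \<delta>))"
definition "X' = (\<lambda>(t, x). (0::real, l * x + (exp t - 1) * (\<kappa> - l * \<beta>)))"
definition "Y' = (\<lambda>(t, x::real). (\<alpha>, exp t * (\<alpha> * \<beta>)))"

text \<open>The range of the velocity \<open>v = \<alpha> u\<close> of \<open>t\<close>; the minimum and maximum account for the sign of
  \<open>\<alpha>\<close>.\<close>

definition "vm = min (\<alpha> * um) (\<alpha> * up)"
definition "vp = max (\<alpha> * um) (\<alpha> * up)"

lemma vm_neg: "vm < 0" and vp_pos: "0 < vp"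
  using nonzero(3) range
  by (auto simp: vm_def vp_def min_less_iff_disj less_max_iff_disj mult_less_0_iff zero_less_mult_iff)

lemma velocity_iff: "u \<in> {um..up} \<longleftrightarrow> \<alpha> * u \<in> {vm..vp}"
proof (cases "\<alpha> > 0")
  case True
  then have "vm = \<alpha> * um" "vp = \<alpha> * up" using range by (auto simp: vm_def vp_def)
  then show ?thesis using True by simp
next
  case False
  then have "\<alpha> < 0" using nonzero by simp
  then have "vm = \<alpha> * up" "vp = \<alpha> * um" using range by (auto simp: vm_def vp_def min_def max_def)
  then show ?thesis using \<open>\<alpha> < 0\<close> by auto
qed

text \<open>With \<open>w = x - \<beta> (exp t - 1)\<close> these are the functions \<open>q = 1 - (l / \<kappa>) w\<close> and \<open>r = q exp (- t)\<close>,
  chosen so that the equation of \<open>q\<close> does not contain the control and that of \<open>r\<close> does not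
  contain \<open>t\<close>.\<close>

definition "q = (\<lambda>(t, x). 1 - l / \<kappa> * (x - \<beta> * (exp t - 1)))"
definition "r = (\<lambda>p. q p * exp (- fst p))"

lemma continuous_on_q: "continuous_on A q"
  unfolding q_def case_prod_unfold by (intro continuous_intros)

lemma continuous_on_r: "continuous_on A r"
  unfolding r_def by (intro continuous_intros continuous_on_q)

lemma projects: "projects_to fst fst X X'" "projects_to fst fst Y Y'"
  by (auto simp: projects_to_def X_def X'_def Y_def Y'_def)

lemma solution_derivatives:
  assumes "is_solution shift_Aff X' Y' u p \<gamma>"
  obtains D where "locally_finite_set D"
    "\<And>s. s \<notin> D \<Longrightarrow> ((\<lambda>s. fst (\<gamma> s)) has_real_derivative \<alpha> * u s) (at s)"
    "\<And>s. s \<notin> D \<Longrightarrow> ((\<lambda>s. q (\<gamma> s)) has_real_derivative l * (q (\<gamma> s) - exp (fst (\<gamma> s)))) (at s)"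
proof -
  obtain D where D: "locally_finite_set D"
    "\<And>s. s \<notin> D \<Longrightarrow> (\<gamma> has_vector_derivative (X' (\<gamma> s) + u s *\<^sub>R Y' (\<gamma> s))) (at s)"
    using assms unfolding is_solution_def has_velocity_shift_Aff_iff by blast
  have 1: "((\<lambda>s. fst (\<gamma> s)) has_real_derivative \<alpha> * u s) (at s)"
    and 2: "((\<lambda>s. snd (\<gamma> s)) has_real_derivative
      l * snd (\<gamma> s) + (exp (fst (\<gamma> s)) - 1) * (\<kappa> - l * \<beta>) + u s * (exp (fst (\<gamma> s)) * (\<alpha> * \<beta>))) (at s)"
    if "s \<notin> D" for s
  proof -
    note d = D(2)[OF that, unfolded has_vector_derivative_def]
    show "((\<lambda>s. fst (\<gamma> s)) has_real_derivative \<alpha> * u s) (at s)"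
      using has_derivative_fst[OF d] unfolding has_field_derivative_def
      by (rule has_derivative_eq_rhs) (auto simp: X'_def Y'_def case_prod_unfold fun_eq_iff)
    show "((\<lambda>s. snd (\<gamma> s)) has_real_derivative
      l * snd (\<gamma> s) + (exp (fst (\<gamma> s)) - 1) * (\<kappa> - l * \<beta>) + u s * (exp (fst (\<gamma> s)) * (\<alpha> * \<beta>))) (at s)"
      using has_derivative_snd[OF d] unfolding has_field_derivative_def
      by (rule has_derivative_eq_rhs) (auto simp: X'_def Y'_def case_prod_unfold fun_eq_iff)
  qed
  have "((\<lambda>s. q (\<gamma> s)) has_real_derivative l * (q (\<gamma> s) - exp (fst (\<gamma> s)))) (at s)" if "s \<notin> D" for s
    unfolding q_def case_prod_unfold
    by (rule derivative_eq_intros 1[OF that] 2[OF that] refl)+ (use nonzero in \<open>simp add: field_simps\<close>)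
  with D(1) 1 show thesis by (rule that)
qed

text \<open>Along a trajectory with velocity \<open>v\<close> of \<open>t\<close>, the derivative of
  \<open>exp (- l s) (q - c exp t - k)\<close> is \<open>exp (- l s) (exp t ((l - v) c - l) + l k)\<close>. The factor
  \<open>exp (- l s)\<close> removes the terms in \<open>q\<close>, so the sign of the derivative can be read off from
  \<open>c\<close>, \<open>k\<close> and the range of \<open>v\<close>. The case \<open>c = 0\<close> compares \<open>q\<close> with \<open>k\<close>, the case \<open>k = 0\<close> compares
  \<open>r\<close> with \<open>c\<close>; the parameter \<open>\<sigma>\<close> selects the direction.\<close>

lemma barrier_increasing:
  assumes sol: "is_solution shift_Aff X' Y' u p \<gamma>" and u: "u \<in> controls {um..up}" and S: "S \<ge> 0"
    and ineq: "\<And>v t. v \<in> {vm..vp} \<Longrightarrow> 0 \<le> \<sigma> * (exp t * ((l - v) * c - l) + l * k)"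
  shows "\<sigma> * (q p - c * exp (fst p) - k)
    \<le> exp (- l * S) * (\<sigma> * (q (\<gamma> S) - c * exp (fst (\<gamma> S)) - k))"
proof -
  obtain D where D: "locally_finite_set D"
    "\<And>s. s \<notin> D \<Longrightarrow> ((\<lambda>s. fst (\<gamma> s)) has_real_derivative \<alpha> * u s) (at s)"
    "\<And>s. s \<notin> D \<Longrightarrow> ((\<lambda>s. q (\<gamma> s)) has_real_derivative l * (q (\<gamma> s) - exp (fst (\<gamma> s)))) (at s)"
    using solution_derivatives[OF sol] by blast
  define H where "H = (\<lambda>s. exp (- l * s) * (\<sigma> * (q (\<gamma> s) - c * exp (fst (\<gamma> s)) - k)))"
  define h where "h = (\<lambda>s. exp (- l * s) * (\<sigma> * (exp (fst (\<gamma> s)) * ((l - \<alpha> * u s) * c - l) + l * k)))"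
  have cont: "continuous_on UNIV \<gamma>" and start: "\<gamma> 0 = p" using sol by (auto simp: is_solution_def)
  have "(h has_integral H S - H 0) {0..S}"
  proof (rule fundamental_theorem_of_calculus_interior_strong)
    show "finite (D \<inter> {0..S})" using D(1) by (simp add: locally_finite_set_def)
    show "0 \<le> S" by (fact S)
    fix s assume "s \<in> {0<..<S} - D \<inter> {0..S}"
    then have s: "s \<notin> D" by auto
    show "(H has_vector_derivative h s) (at s)"
      unfolding has_real_derivative_iff_has_vector_derivative[symmetric] H_def h_def
      by (rule derivative_eq_intros D(2,3)[OF s] refl)+ (simp add: algebra_simps)
  next
    have c: "continuous_on UNIV (\<lambda>s. q (\<gamma> s))"
      by (rule continuous_on_compose2[OF continuous_on_q cont]) auto
    show "continuous_on {0..S} H" unfolding H_def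
      by (intro continuous_intros continuous_on_subset[OF c] continuous_on_subset[OF cont]) auto
  qed
  moreover have "0 \<le> h s" for s
    unfolding h_def using u velocity_iff[of "u s"] ineq[of "\<alpha> * u s" "fst (\<gamma> s)"]
    by (auto simp: controls_def image_subset_iff)
  ultimately have "0 \<le> H S - H 0" by (rule has_integral_nonneg)
  then show ?thesis by (simp add: H_def start)
qed

abbreviation "orbit_Aff \<equiv> positive_orbit shift_Aff X' Y' {um..up}"
abbreviation "pre_control_Aff \<equiv> pre_control_set shift_Aff X' Y' {um..up}"

text \<open>The side of a barrier that trajectories cannot leave is closed and positively invariant, so points
  that approximate each other along trajectories cannot be separated by it.\<close>

lemma barrier:
  assumes "pre_control_Aff D"
    and ineq: "\<And>v t. v \<in> {vm..vp} \<Longrightarrow> 0 \<le> \<sigma> * (exp t * ((l - v) * c - l) + l * k)"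
    and d: "d \<in> D" "0 \<le> \<sigma> * (q d - c * exp (fst d) - k)" and d': "d' \<in> D"
  shows "0 \<le> \<sigma> * (q d' - c * exp (fst d') - k)"
proof -
  let ?P = "{p. 0 \<le> \<sigma> * (q p - c * exp (fst p) - k)}"
  have "D \<subseteq> ?P"
  proof (rule pre_control_set_subset_invariant[OF assms(1)])
    show "closed ?P"
      by (intro closed_Collect_le continuous_intros continuous_on_q)
    fix p assume p: "p \<in> ?P"
    show "orbit_Aff p \<subseteq> ?P"
    proof
      fix p' assume "p' \<in> orbit_Aff p"
      then obtain S u \<gamma> where "p' = \<gamma> S" "S > 0" "u \<in> controls {um..up}"
          "is_solution shift_Aff X' Y' u p \<gamma>" unfolding positive_orbit_def by blast
      then have "0 \<le> exp (- l * S) * (\<sigma> * (q p' - c * exp (fst p') - k))"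
        using barrier_increasing[of u p \<gamma> S \<sigma> c k] ineq p by auto
      then show "p' \<in> ?P" by (simp add: zero_le_mult_iff)
    qed
  qed (use d in auto)
  then show ?thesis using d' by auto
qed

lemma barrier_q_ge:
  assumes "pre_control_Aff D" "l < 0" "c \<le> 0" "d \<in> D" "d' \<in> D" "c \<le> q d"
  shows "c \<le> q d'"
proof -
  have "0 \<le> 1 * (q d' - 0 * exp (fst d') - c)"
  proof (rule barrier[OF assms(1) _ assms(4) _ assms(5)])
    show "0 \<le> 1 * (exp t * ((l - v) * 0 - l) + l * c)" for v t
      using assms(2) order_trans[OF assms(3) exp_ge_zero[of t]] by simp
  qed (use assms in auto)
  then show ?thesis by simp
qed

lemma barrier_q_le:
  assumes "pre_control_Aff D" "l > 0" "c \<le> 0" "d \<in> D" "d' \<in> D" "q d \<le> c"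
  shows "q d' \<le> c"
proof -
  have "0 \<le> (-1) * (q d' - 0 * exp (fst d') - c)"
  proof (rule barrier[OF assms(1) _ assms(4) _ assms(5)])
    show "0 \<le> (-1) * (exp t * ((l - v) * 0 - l) + l * c)" for v t
      using assms(2) order_trans[OF assms(3) exp_ge_zero[of t]] by simp
  qed (use assms in auto)
  then show ?thesis by simp
qed

lemma r_ge_iff: "c \<le> r p \<longleftrightarrow> 0 \<le> q p - c * exp (fst p) - 0"
  and r_le_iff: "r p \<le> c \<longleftrightarrow> q p - c * exp (fst p) - 0 \<le> 0"
  by (simp_all add: r_def exp_minus divide_simps)

text \<open>The inequality for all velocities follows from the one for \<open>vp\<close> because \<open>c\<close> is nonnegative.
  For negative \<open>c\<close> the barrier can fail, which is why \<open>q\<close> is needed to settle the sign first.\<close>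

lemma barrier_r_ge:
  assumes "pre_control_Aff D" "0 \<le> c" "l \<le> (l - vp) * c" "d \<in> D" "d' \<in> D" "c \<le> r d"
  shows "c \<le> r d'"
proof -
  have "0 \<le> 1 * (q d' - c * exp (fst d') - 0)"
  proof (rule barrier[OF assms(1) _ assms(4) _ assms(5)])
    fix v t assume "v \<in> {vm..vp}"
    then have "(l - vp) * c \<le> (l - v) * c" using assms(2) by (intro mult_right_mono) auto
    then show "0 \<le> 1 * (exp t * ((l - v) * c - l) + l * 0)" using assms(3) by simp
  qed (use assms r_ge_iff in auto)
  then show ?thesis using r_ge_iff by simp
qed

lemma barrier_r_le:
  assumes "pre_control_Aff D" "0 \<le> c" "(l - vm) * c \<le> l" "d \<in> D" "d' \<in> D" "r d \<le> c"
  shows "r d' \<le> c"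
proof -
  have "0 \<le> (-1) * (q d' - c * exp (fst d') - 0)"
  proof (rule barrier[OF assms(1) _ assms(4) _ assms(5)])
    fix v t assume "v \<in> {vm..vp}"
    then have "(l - v) * c \<le> (l - vm) * c" using assms(2) by (intro mult_right_mono) auto
    then show "0 \<le> (-1) * (exp t * ((l - v) * c - l) + l * 0)" using assms(3)
      by (simp add: mult_nonneg_nonpos)
  qed (use assms r_le_iff in auto)
  then show ?thesis using r_le_iff by simp
qed

text \<open>Both functions are injective in \<open>x\<close> for fixed \<open>t\<close>.\<close>

lemma interior_not_constant:
  assumes "l \<noteq> 0" "interior D \<noteq> {}"
  shows "\<exists>d\<in>D. q d \<noteq> c" "\<exists>d\<in>D. r d \<noteq> c"
proof -
  obtain t x where "(t, x) \<in> interior D" using assms(2) by auto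
  then obtain e where e: "e > 0" "ball (t, x) e \<subseteq> D"
    using mem_interior by blast
  then have in_D: "(t, x) \<in> D" "(t, x + e / 2) \<in> D"
    by (auto simp: subset_iff dist_Pair_Pair dist_real_def)
  have q: "q (t, x + e / 2) \<noteq> q (t, x)"
    using assms(1) nonzero(1) e(1) by (simp add: q_def)
  then have "r (t, x + e / 2) \<noteq> r (t, x)" by (simp add: r_def)
  with q in_D show "\<exists>d\<in>D. q d \<noteq> c" "\<exists>d\<in>D. r d \<noteq> c" by metis+
qed

text \<open>For \<open>l > 0\<close> no trajectory outside moves back towards the bounds: wherever a bound fails, every
  level that the set attains beyond that point is a barrier. Two points with different values are
  then separated by the barrier at the more extreme of their levels. The bounds come out strict.\<close>

lemma pre_control_set_bounds_pos:
  assumes pre: "pre_control_Aff D" and int: "interior D \<noteq> {}" and l: "l > 0" and d: "d \<in> D"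
  shows "(l - vp) * r d < l \<and> l < (l - vm) * r d"
proof -
  note nonconst = interior_not_constant[OF _ int]
  have q: "q d > 0" if "d \<in> D" for d
  proof (rule ccontr)
    assume neg: "\<not> q d > 0"
    obtain d' where d': "d' \<in> D" "q d' \<noteq> q d" using nonconst l by blast
    then show False
      using barrier_q_le[OF pre l _ that d'(1), of "q d"] barrier_q_le[OF pre l _ d'(1) that, of "q d'"] neg
      by linarith
  qed
  have r: "r d > 0" if "d \<in> D" for d using q[OF that] by (simp add: r_def)
  obtain d' where d': "d' \<in> D" "r d' \<noteq> r d" using nonconst l by blast
  have "l < (l - vm) * r d"
  proof (rule ccontr)
    assume le: "\<not> l < (l - vm) * r d"
    define m where "m = min (r d) (r d')"
    have m: "0 \<le> m" using r d d' by (auto simp: m_def less_imp_le)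
    have "(l - vm) * m \<le> (l - vm) * r d" using l vm_neg by (intro mult_left_mono) (auto simp: m_def)
    then have "(l - vm) * m \<le> l" using le by simp
    then have "r d \<le> m \<and> r d' \<le> m"
      using barrier_r_le[OF pre m] d d'(1) unfolding m_def by (meson min_le_iff_disj order_refl)
    then show False using d'(2) by (auto simp: m_def)
  qed
  moreover have "(l - vp) * r d < l"
  proof (rule ccontr)
    assume le: "\<not> (l - vp) * r d < l"
    define m where "m = max (r d) (r d')"
    have m: "0 \<le> m" using r d d' by (auto simp: m_def less_imp_le le_max_iff_disj)
    have "0 < (l - vp) * r d" using le l by linarith
    then have "0 < l - vp" using r[OF d] by (simp add: zero_less_mult_iff)
    then have "(l - vp) * r d \<le> (l - vp) * m" by (intro mult_left_mono) (auto simp: m_def)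
    then have "l \<le> (l - vp) * m" using le by simp
    then have "m \<le> r d \<and> m \<le> r d'"
      using barrier_r_ge[OF pre m] d d'(1) unfolding m_def by (meson le_max_iff_disj order_refl max.bounded_iff linear)
    then show False using d'(2) by (auto simp: m_def)
  qed
  ultimately show ?thesis by simp
qed

text \<open>For \<open>l < 0\<close> no trajectory outside recedes from the bounds, so the barriers are the outer levels up
  to and including the boundary value, and two points on different sides of one cannot approximate each other. If
  the second point is not outside, the boundary value itself separates them; on the boundary there
  is nothing left to separate, so only weak bounds result.\<close>

lemma pre_control_set_bounds_neg:
  assumes pre: "pre_control_Aff D" and int: "interior D \<noteq> {}" and l: "l < 0" and d: "d \<in> D"
  shows "(l - vp) * r d \<le> l \<and> l \<le> (l - vm) * r d"
proof -
  note nonconst = interior_not_constant[OF _ int]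
  have q: "q d \<ge> 0" if d: "d \<in> D" for d
  proof (rule ccontr)
    assume neg: "\<not> q d \<ge> 0"
    obtain d' where d': "d' \<in> D" "q d' \<noteq> q d" using nonconst l by blast
    show False
      using barrier_q_ge[OF pre l _ d d'(1), of "q d"] barrier_q_ge[OF pre l _ d'(1) d, of "min (q d') 0"]
        neg d'(2) by (cases "q d' \<le> 0") (auto simp: min_def)
  qed
  have r: "r d \<ge> 0" if "d \<in> D" for d using q[OF that] by (simp add: r_def)
  obtain d' where d': "d' \<in> D" "r d' \<noteq> r d" using nonconst l by blast
  have "(l - vp) * r d \<le> l"
  proof (rule ccontr)
    assume gt: "\<not> (l - vp) * r d \<le> l"
    define b where "b = l / (l - vp)"
    have neg: "l - vp < 0" using l vp_pos by simp
    have b: "r d < b" "0 \<le> b" using gt neg l by (auto simp: b_def field_simps divide_nonpos_neg)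
    have inv: "m \<le> r e'" if "0 \<le> m" "m \<le> b" "e \<in> D" "e' \<in> D" "m \<le> r e" for m e e'
    proof -
      have "(l - vp) * b \<le> (l - vp) * m" using that(2) neg by (intro mult_left_mono_neg) auto
      then have "l \<le> (l - vp) * m" using neg by (simp add: b_def)
      then show ?thesis using barrier_r_ge[OF pre that(1) _ that(3,4,5)] by simp
    qed
    show False
    proof (cases "r d' < r d")
      case True
      then show False using inv[of "r d" d d'] r d d' b by auto
    next
      case False
      then show False using inv[of "min (r d') b" d' d] r[OF d'(1)] d d' b
        by (cases "r d' \<le> b") (auto simp: min_def)
    qed
  qed
  moreover have "l \<le> (l - vm) * r d"
  proof (rule ccontr)
    assume lt: "\<not> l \<le> (l - vm) * r d"
    define b where "b = l / (l - vm)"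
    have neg: "l - vm < 0"
    proof (rule ccontr)
      assume "\<not> l - vm < 0"
      then have "0 \<le> (l - vm) * r d" using r[OF d] by simp
      then show False using lt l by linarith
    qed
    have b: "b < r d" "0 \<le> b" using lt neg l by (auto simp: b_def field_simps divide_nonpos_neg)
    have inv: "r e' \<le> m" if "b \<le> m" "e \<in> D" "e' \<in> D" "r e \<le> m" for m e e'
    proof -
      have "(l - vm) * m \<le> (l - vm) * b" using that(1) neg by (intro mult_left_mono_neg) auto
      then have "(l - vm) * m \<le> l" using neg by (simp add: b_def)
      then show ?thesis using barrier_r_le[OF pre _ _ that(2,3,4)] b(2) that(1) by simp
    qed
    show False
    proof (cases "r d < r d'")
      case True
      then show False using inv[of "r d" d d'] d d' b by auto
    next
      case False
      then show False using inv[of "max (r d') b" d' d] d d' b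
        by (cases "r d' \<le> b") (auto simp: max_def)
    qed
  qed
  ultimately show ?thesis by simp
qed

end


section \<open>Flows of constant controls\<close>

lemma rotate_circle_abs: "rotate_circle (abs_circle a) c = abs_circle (a + c)"
  by (rule rotate_circle.abs_eq)

lemma continuous_on_abs_circle: "continuous_on UNIV abs_circle"
  by (simp add: continuous_on_open_vimage open_circle_def)

lemma abs_circle_period: "abs_circle (y + 2 * pi * of_int k) = abs_circle y"
  unfolding circle.abs_eq_iff by (rule exI[of _ k]) simp

lemma abs_circle_surj: "\<exists>y. z = abs_circle y"
  by (metis Quotient3_abs_rep[OF Quotient3_circle])

context affine_circle_system
begin

text \<open>The point with coordinates \<open>(t, w, z)\<close>, where \<open>z\<close> counts modulo \<open>2 \<pi>\<close>; the control does not enter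
  the equations of \<open>w\<close> and \<open>z\<close>.\<close>

definition point :: "real \<Rightarrow> real \<Rightarrow> real \<Rightarrow> (real \<times> real) \<times> circle"
  where "point t w z = ((t, \<beta> * (exp t - 1) + w), abs_circle (z + \<delta> * t))"

lemma ex_point: "\<exists>t w z. m = point t w z"
proof -
  obtain t x c where m: "m = ((t, x), c)" by (metis surj_pair)
  obtain y where "c = abs_circle y" using abs_circle_surj by blast
  then have "m = point t (x - \<beta> * (exp t - 1)) (y - \<delta> * t)" by (simp add: m point_def)
  then show ?thesis by blast
qed

lemma point_period: "point t w (z + 2 * pi * of_int k) = point t w z"
  using abs_circle_period[of "z + \<delta> * t" k] by (simp add: point_def algebra_simps)

lemma constant_control_solution:
  assumes w: "\<And>s. (w has_real_derivative l * w s + \<kappa> * (exp (t + v * s) - 1)) (at s)"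
  shows "is_solution shift_S1 X Y (\<lambda>_. v / \<alpha>) (point t (w 0) z)
    (\<lambda>s. point (t + v * s) (w s) (z + \<omega> * (t * s + v * s\<^sup>2 / 2)))"
proof -
  let ?x = "\<lambda>s. \<beta> * (exp (t + v * s) - 1) + w s"
  let ?y = "\<lambda>s. z + \<omega> * (t * s + v * s\<^sup>2 / 2) + \<delta> * (t + v * s)"
  let ?\<gamma> = "\<lambda>s. point (t + v * s) (w s) (z + \<omega> * (t * s + v * s\<^sup>2 / 2))"
  have \<gamma>: "?\<gamma> s = ((t + v * s, ?x s), abs_circle (?y s))" for s by (simp add: point_def)
  have vel: "has_velocity shift_S1 ?\<gamma> (X (?\<gamma> s) + (v / \<alpha>) *\<^sub>R Y (?\<gamma> s)) s" for s
  proof -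
    let ?c = "\<lambda>a. ((v * (a - s), ?x a - ?x s), ?y a - ?y s)"
    have f: "X (?\<gamma> s) + (v / \<alpha>) *\<^sub>R Y (?\<gamma> s) =
      ((v, \<beta> * (exp (t + v * s) * v) + (l * w s + \<kappa> * (exp (t + v * s) - 1))), \<omega> * (t + v * s) + \<delta> * v)"
      unfolding \<gamma> X_def Y_def prod.case using nonzero(3) by (simp add: algebra_simps)
    have x: "(?x has_real_derivative \<beta> * (exp (t + v * s) * v) + (l * w s + \<kappa> * (exp (t + v * s) - 1))) (at s)"
      by (rule derivative_eq_intros w refl | simp)+
    have y: "(?y has_real_derivative \<omega> * (t + v * s) + \<delta> * v) (at s)"
      by (rule derivative_eq_intros refl | simp)+
    have "(?c has_vector_derivative (X (?\<gamma> s) + (v / \<alpha>) *\<^sub>R Y (?\<gamma> s))) (at s)"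
      unfolding f
    proof (intro has_vector_derivative_Pair)
      show "((\<lambda>a. v * (a - s)) has_vector_derivative v) (at s)"
        by (auto intro!: derivative_eq_intros)
    next
      show "((\<lambda>a. ?x a - ?x s) has_vector_derivative
          \<beta> * (exp (t + v * s) * v) + (l * w s + \<kappa> * (exp (t + v * s) - 1))) (at s)"
        using DERIV_diff[OF x DERIV_const[of "?x s"]]
        unfolding has_real_derivative_iff_has_vector_derivative diff_0_right .
      show "((\<lambda>a. ?y a - ?y s) has_vector_derivative \<omega> * (t + v * s) + \<delta> * v) (at s)"
        using DERIV_diff[OF y DERIV_const[of "?y s"]]
        unfolding has_real_derivative_iff_has_vector_derivative diff_0_right .
    qed
    moreover have "?\<gamma> a = shift_S1 (?\<gamma> s) (?c a)" for a
      unfolding \<gamma> by (simp add: shift_S1_def rotate_circle_abs algebra_simps)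
    then have "\<forall>\<^sub>F a in nhds s. ?\<gamma> a = shift_S1 (?\<gamma> s) (?c a)" by (intro always_eventually allI)
    moreover have "?c s = 0" by (simp add: zero_prod_def)
    ultimately have "?c s = 0 \<and> (\<forall>\<^sub>F a in nhds s. ?\<gamma> a = shift_S1 (?\<gamma> s) (?c a)) \<and>
        (?c has_vector_derivative (X (?\<gamma> s) + (v / \<alpha>) *\<^sub>R Y (?\<gamma> s))) (at s)"
      by (intro conjI)
    then show ?thesis unfolding has_velocity_def by (rule exI[of _ ?c])
  qed
  have "continuous_on UNIV w"
    using w by (meson DERIV_isCont continuous_at_imp_continuous_on)
  then have "continuous_on UNIV ?\<gamma>" unfolding \<gamma>
    by (intro continuous_on_Pair continuous_intros continuous_on_compose2[OF continuous_on_abs_circle]) auto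
  then show ?thesis unfolding is_solution_def
    using vel locally_finite_set_empty by auto
qed

abbreviation "orbit_S1 \<equiv> positive_orbit shift_S1 X Y {um..up}"
abbreviation "pre_control_S1 \<equiv> pre_control_set shift_S1 X Y {um..up}"

definition reach :: "real \<Rightarrow> real \<Rightarrow> real \<Rightarrow> real \<Rightarrow> real \<Rightarrow> real \<Rightarrow> bool"
  where "reach t w z t' w' z' \<longleftrightarrow> point t' w' z' \<in> orbit_S1 (point t w z)"

lemma reach_trans: "\<lbrakk>reach t w z t' w' z'; reach t' w' z' t'' w'' z''\<rbrakk> \<Longrightarrow> reach t w z t'' w'' z''"
  unfolding reach_def by (rule positive_orbit_trans)

lemma constant_velocity_in_controls: "v \<in> {vm..vp} \<Longrightarrow> (\<lambda>_. v / \<alpha>) \<in> controls {um..up}"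
  using velocity_iff[of "v / \<alpha>"] nonzero(3) by (intro const_in_controls) auto

text \<open>The function \<open>w\<close> is left as a hypothesis so that both trace cases can supply their own closed
  form; the other two coordinates integrate to polynomials.\<close>

lemma reach_constant_control:
  assumes "v \<in> {vm..vp}" "S > 0"
    and "\<And>s. (w has_real_derivative l * w s + \<kappa> * (exp (t + v * s) - 1)) (at s)"
  shows "reach t (w 0) z (t + v * S) (w S) (z + \<omega> * (t * S + v * S\<^sup>2 / 2))"
  using constant_control_solution[OF assms(3), of z] constant_velocity_in_controls[OF assms(1)] assms(2)
  unfolding reach_def positive_orbit_def
  by (intro CollectI exI[of _ S] exI[of _ "\<lambda>_. v / \<alpha>"]
      exI[of _ "\<lambda>s. point (t + v * s) (w s) (z + \<omega> * (t * s + v * s\<^sup>2 / 2))"]) auto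

end

text \<open>The integral of \<open>exp (a \<tau>)\<close> over \<open>\<tau>\<close> from \<open>0\<close> to \<open>s\<close>. It gives the flows a form that covers
  vanishing exponents too.\<close>

definition exp_integral :: "real \<Rightarrow> real \<Rightarrow> real"
  where "exp_integral a s = (if a = 0 then s else (exp (a * s) - 1) / a)"

lemma exp_integral_0 [simp]: "exp_integral a 0 = 0"
  by (simp add: exp_integral_def)

lemma exp_integral_deriv: "(exp_integral a has_real_derivative exp (a * s)) (at s)"
  unfolding exp_integral_def
  by (cases "a = 0") (auto intro!: derivative_eq_intros)

lemma exp_integral_eq: "a * exp_integral a s = exp (a * s) - 1"
  by (simp add: exp_integral_def)

lemma exp_integral_surj:
  assumes "0 < e" "0 < 1 + a * e"
  shows "\<exists>S>0. exp_integral a S = e"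
proof (cases "a = 0")
  case False
  let ?S = "ln (1 + a * e) / a"
  have "?S > 0"
    using assms False by (cases "a > 0") (auto simp: zero_less_divide_iff ln_less_zero_iff mult_neg_pos)
  moreover have "exp_integral a ?S = e" using assms False by (simp add: exp_integral_def)
  ultimately show ?thesis by blast
qed (use assms in \<open>auto simp: exp_integral_def\<close>)

text \<open>Turning by an angle \<open>c\<close> at the rate \<open>x\<close> takes the time \<open>c / x\<close>, which may be negative or too short;
  full turns correct this.\<close>

lemma ex_period_above:
  fixes c x M :: real
  assumes "x \<noteq> 0"
  shows "\<exists>k::int. M < (c + 2 * pi * of_int k) / x"
proof -
  obtain n :: nat where n: "real n * (2 * pi / \<bar>x\<bar>) > M - c / x"
    using reals_Archimedean3[of "2 * pi / \<bar>x\<bar>"] assms by auto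
  let ?k = "if x > 0 then int n else - int n"
  have "(c + 2 * pi * of_int ?k) / x = c / x + real n * (2 * pi / \<bar>x\<bar>)"
    using assms by (auto simp: field_simps)
  then show ?thesis using n by (intro exI[of _ ?k]) linarith
qed

section \<open>Controllability when the trace vanishes\<close>

context affine_circle_system
begin

lemma reach_trace_zero_const:
  assumes "l = 0" "v \<in> {vm..vp}" "S > 0"
  shows "reach t w z (t + v * S) (w + \<kappa> * (exp t * exp_integral v S - S)) (z + \<omega> * (t * S + v * S\<^sup>2 / 2))"
proof -
  have "((\<lambda>s. w + \<kappa> * (exp t * exp_integral v s - s)) has_real_derivative
      l * (w + \<kappa> * (exp t * exp_integral v s - s)) + \<kappa> * (exp (t + v * s) - 1)) (at s)" for s
    by (rule derivative_eq_intros exp_integral_deriv refl)+ (simp add: assms(1) exp_add)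
  from reach_constant_control[OF assms(2,3) this, of z] show ?thesis by simp
qed

lemma reach_trace_zero_stay:
  assumes "l = 0" "S > 0"
  shows "reach t w z t (w + \<kappa> * (exp t - 1) * S) (z + \<omega> * t * S)"
  using reach_trace_zero_const[OF assms(1) _ assms(2), of 0 t w z] vm_neg vp_pos
  by (simp add: exp_integral_def algebra_simps)

text \<open>The displacements of \<open>w\<close> and \<open>z\<close> depend on \<open>t\<close> and \<open>t'\<close> only, so legs can be composed before
  the waiting times are chosen.\<close>

lemma reach_trace_zero_leg:
  assumes "l = 0"
  shows "\<exists>K L. \<forall>w z. reach t w z t' (w + K) (z + L)"
proof -
  consider "t < t'" | "t = t'" | "t' < t" by linarith
  then have "\<exists>v\<in>{vm..vp}. \<exists>S>0. t + v * S = t'"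
  proof cases
    case 1
    then show ?thesis using vp_pos vm_neg
      by (intro bexI[of _ vp] exI[of _ "(t' - t) / vp"]) auto
  next
    case 2
    then show ?thesis using vp_pos vm_neg
      by (intro bexI[of _ 0] exI[of _ 1]) auto
  next
    case 3
    then show ?thesis using vp_pos vm_neg
      by (intro bexI[of _ vm] exI[of _ "(t' - t) / vm"]) (auto simp: divide_neg_neg)
  qed
  then obtain v S where "v \<in> {vm..vp}" "S > 0" "t + v * S = t'" by blast
  with reach_trace_zero_const[OF assms this(1,2), of t] show ?thesis by metis
qed

text \<open>The route passes \<open>t = 1\<close>, waiting there for a time \<open>\<tau>\<close>, and \<open>t = - 1\<close>, waiting for \<open>\<sigma>\<close>.
  Waiting adds \<open>\<kappa> ((e - 1) \<tau> - (1 - 1 / e) \<sigma>)\<close> to \<open>w\<close> and \<open>\<omega> (\<tau> - \<sigma>)\<close> to \<open>z\<close>. The prescribed totals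
  determine \<open>\<tau>\<close> and \<open>\<sigma>\<close>, and these are positive once \<open>\<sigma> - \<tau>\<close> is large.\<close>

lemma reach_trace_zero:
  assumes "l = 0"
  shows "point t' w' z' \<in> orbit_S1 (point t w z)"
proof -
  obtain K1 L1 where 1: "\<And>w z. reach t w z 1 (w + K1) (z + L1)"
    using reach_trace_zero_leg[OF assms] by blast
  obtain K2 L2 where 2: "\<And>w z. reach 1 w z (-1) (w + K2) (z + L2)"
    using reach_trace_zero_leg[OF assms] by blast
  obtain K3 L3 where 3: "\<And>w z. reach (-1) w z t' (w + K3) (z + L3)"
    using reach_trace_zero_leg[OF assms] by blast
  define e where "e = exp (1::real)"
  have e: "e > 1" "exp (-1) = 1 / e" by (auto simp: e_def exp_minus divide_inverse)
  define A where "A = (w' - w - K1 - K2 - K3) / (\<kappa> * (1 - 1 / e))"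
  obtain k :: int where k: "max 0 (- A) < ((- (z' - z - L1 - L2 - L3)) + 2 * pi * of_int k) / \<omega>"
    using ex_period_above[OF nonzero(2)] by blast
  define B where "B = ((- (z' - z - L1 - L2 - L3)) + 2 * pi * of_int k) / \<omega>"
  \<comment> \<open>Solution of \<open>e \<tau> - \<sigma> = A\<close> and \<open>\<sigma> - \<tau> = B\<close>.\<close>
  define \<tau> where "\<tau> = (A + B) / (e - 1)"
  define \<sigma> where "\<sigma> = \<tau> + B"
  have B: "B > 0" "A + B > 0" using k by (auto simp: B_def)
  have pos: "\<tau> > 0" "\<sigma> > 0" using B e by (auto simp: \<tau>_def \<sigma>_def add_pos_pos)
  have "reach t w z 1 (w + K1) (z + L1)" by (rule 1)
  note reach_trans[OF this reach_trace_zero_stay[OF assms pos(1)]]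
  note reach_trans[OF this 2]
  note reach_trans[OF this reach_trace_zero_stay[OF assms pos(2)]]
  note r = reach_trans[OF this 3]
  have "\<kappa> * (exp 1 - 1) * \<tau> + \<kappa> * (exp (-1) - 1) * \<sigma> = \<kappa> * (1 - 1 / e) * (e * \<tau> - \<sigma>)"
    using e by (simp add: e_def[symmetric] field_simps)
  also have "e * \<tau> - \<sigma> = (e - 1) * \<tau> - B" by (simp add: \<sigma>_def algebra_simps)
  also have "\<dots> = A" using e by (simp add: \<tau>_def)
  also have "\<kappa> * (1 - 1 / e) * A = w' - w - K1 - K2 - K3"
    using e nonzero by (simp add: A_def)
  finally have W: "w + K1 + \<kappa> * (exp 1 - 1) * \<tau> + K2 + \<kappa> * (exp (-1) - 1) * \<sigma> + K3 = w'" by simp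
  have "\<omega> * 1 * \<tau> + \<omega> * (-1) * \<sigma> = - (\<omega> * B)" by (simp add: \<sigma>_def algebra_simps)
  also have "\<dots> = z' - z - L1 - L2 - L3 - 2 * pi * of_int k" using nonzero by (simp add: B_def)
  finally have Z: "z + L1 + \<omega> * 1 * \<tau> + L2 + \<omega> * (-1) * \<sigma> + L3 = z' + 2 * pi * of_int (- k)" by simp
  show ?thesis using r unfolding W Z unfolding reach_def point_period .
qed

section \<open>Controllability inside the cone when the trace does not vanish\<close>

text \<open>The point with slope \<open>\<rho>\<close>, obtained by solving \<open>r = \<rho>\<close> for \<open>w\<close>.\<close>

definition cone_point :: "real \<Rightarrow> real \<Rightarrow> real \<Rightarrow> (real \<times> real) \<times> circle"
  where "cone_point t \<rho> z = point t (\<kappa> / l * (1 - \<rho> * exp t)) z"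

definition cone_reach :: "real \<Rightarrow> real \<Rightarrow> real \<Rightarrow> real \<Rightarrow> real \<Rightarrow> real \<Rightarrow> bool"
  where "cone_reach t \<rho> z t' \<rho>' z' \<longleftrightarrow> cone_point t' \<rho>' z' \<in> orbit_S1 (cone_point t \<rho> z)"

lemma cone_reach_trans:
  "\<lbrakk>cone_reach t \<rho> z t' \<rho>' z'; cone_reach t' \<rho>' z' t'' \<rho>'' z''\<rbrakk> \<Longrightarrow> cone_reach t \<rho> z t'' \<rho>'' z''"
  unfolding cone_reach_def by (rule positive_orbit_trans)

lemma r_cone_point: "l \<noteq> 0 \<Longrightarrow> r (fst (cone_point t \<rho> z)) = \<rho>"
  using nonzero(1) by (simp add: cone_point_def point_def r_def q_def exp_minus)

lemma ex_cone_point: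
  assumes "l \<noteq> 0"
  shows "\<exists>t z. m = cone_point t (r (fst m)) z"
proof -
  obtain t w z where m: "m = point t w z" using ex_point by blast
  have "\<kappa> / l * (1 - r (fst m) * exp t) = w"
    using nonzero(1) assms by (simp add: m point_def r_def q_def exp_minus field_simps)
  then have "m = cone_point t (r (fst m)) z" using m by (simp add: cone_point_def)
  then show ?thesis by blast
qed

text \<open>The slope solves \<open>\<rho>' = (l - v) \<rho> - l\<close>, whose flow moves \<open>\<rho>\<close> in proportion to its initial
  velocity; the rest is the translation of this equation back to \<open>w\<close>.\<close>

lemma cone_flow_deriv:
  assumes "l \<noteq> 0"
  shows "((\<lambda>s. \<kappa> / l * (1 - (\<rho> + ((l - v) * \<rho> - l) * exp_integral (l - v) s) * exp (t + v * s)))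
    has_real_derivative l * (\<kappa> / l * (1 - (\<rho> + ((l - v) * \<rho> - l) * exp_integral (l - v) s) * exp (t + v * s)))
      + \<kappa> * (exp (t + v * s) - 1)) (at s)"
proof -
  define E where "E = exp_integral (l - v) s"
  have "((\<lambda>s. \<kappa> / l * (1 - (\<rho> + ((l - v) * \<rho> - l) * exp_integral (l - v) s) * exp (t + v * s)))
    has_real_derivative - (\<kappa> / l * (((l - v) * \<rho> - l) * exp ((l - v) * s) * exp (t + v * s)
      + (\<rho> + ((l - v) * \<rho> - l) * E) * (exp (t + v * s) * v)))) (at s)"
    unfolding E_def by (rule derivative_eq_intros exp_integral_deriv refl)+ (use assms in \<open>simp add: field_simps\<close>)
  moreover have x: "exp ((l - v) * s) = 1 + (l - v) * E"
    using exp_integral_eq[of "l - v" s] by (simp add: E_def)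
  have "- (\<kappa> / l * (((l - v) * \<rho> - l) * exp ((l - v) * s) * exp (t + v * s)
      + (\<rho> + ((l - v) * \<rho> - l) * E) * (exp (t + v * s) * v)))
    = l * (\<kappa> / l * (1 - (\<rho> + ((l - v) * \<rho> - l) * E) * exp (t + v * s))) + \<kappa> * (exp (t + v * s) - 1)"
    unfolding x using assms by (simp add: field_simps)
  ultimately show ?thesis by (simp add: E_def)
qed

lemma cone_reach_const:
  assumes "l \<noteq> 0" "v \<in> {vm..vp}" "S > 0"
  shows "cone_reach t \<rho> z (t + v * S) (\<rho> + ((l - v) * \<rho> - l) * exp_integral (l - v) S)
    (z + \<omega> * (t * S + v * S\<^sup>2 / 2))"
  using reach_constant_control[OF assms(2,3) cone_flow_deriv[OF assms(1)], of t \<rho> z]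
  by (simp add: cone_reach_def cone_point_def reach_def)

text \<open>The slopes that the extreme velocities move in opposite directions; the closed version also
  admits slopes that an extreme velocity leaves fixed.\<close>

definition "slopes = {\<rho>. (l - vp) * \<rho> < l \<and> l < (l - vm) * \<rho>}"
definition "closed_slopes = {\<rho>. (l - vp) * \<rho> \<le> l \<and> l \<le> (l - vm) * \<rho>}"

lemma slopes_subset: "slopes \<subseteq> closed_slopes"
  by (auto simp: slopes_def closed_slopes_def)

lemma one_in_slopes: "1 \<in> slopes"
  using vm_neg vp_pos by (simp add: slopes_def)

lemma closed_slopes_pos:
  assumes "l \<noteq> 0" "\<rho> \<in> closed_slopes"
  shows "\<rho> > 0"
proof -
  have "0 \<le> (vp - vm) * \<rho>" using assms(2) by (simp add: closed_slopes_def algebra_simps)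
  then have "\<rho> \<ge> 0" using vm_neg vp_pos by (simp add: zero_le_mult_iff)
  moreover have "\<rho> \<noteq> 0" using assms by (auto simp: closed_slopes_def)
  ultimately show ?thesis by simp
qed

text \<open>The velocity of \<open>t\<close> that keeps the slope \<open>\<rho>\<close> constant.\<close>

definition "ride \<rho> = l * (1 - 1 / \<rho>)"

lemma ride_in_range:
  assumes "l \<noteq> 0" "\<rho> \<in> closed_slopes"
  shows "ride \<rho> \<in> {vm..vp}" "(l - ride \<rho>) * \<rho> - l = 0"
  using closed_slopes_pos[OF assms] assms(2)
  by (auto simp: ride_def closed_slopes_def field_simps)

lemma cone_reach_ride:
  assumes "l \<noteq> 0" "\<rho> \<in> closed_slopes" "S > 0"
  shows "cone_reach t \<rho> z (t + ride \<rho> * S) \<rho> (z + \<omega> * (t * S + ride \<rho> * S\<^sup>2 / 2))"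
  using cone_reach_const[OF assms(1) ride_in_range(1)[OF assms(1,2)] assms(3), of t \<rho> z]
    ride_in_range(2)[OF assms(1,2)] by simp

text \<open>An extreme velocity moves \<open>\<rho>\<close> towards \<open>\<rho>'\<close>, and since the rate \<open>(l - v) \<rho> - l\<close> is affine in \<open>\<rho>\<close>
  with the same sign at both ends, it does not stall in between. The displacement
  \<open>T\<close> is independent of \<open>t\<close> and \<open>L\<close> is independent of \<open>z\<close>; this uniformity allows later corrections.
  Equal slopes are joined by keeping the slope constant.\<close>

lemma cone_reach_transfer:
  assumes "l \<noteq> 0" "\<rho> \<in> slopes" "\<rho>' \<in> slopes"
  shows "\<exists>T. \<forall>t. \<exists>L. \<forall>z. cone_reach t \<rho> z (t + T) \<rho>' (z + L)"
proof -
  have "\<exists>v\<in>{vm..vp}. \<exists>S>0. \<rho> + ((l - v) * \<rho> - l) * exp_integral (l - v) S = \<rho>'"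
  proof (cases "\<rho> = \<rho>'")
    case True
    then show ?thesis using ride_in_range[OF assms(1), of \<rho>] assms(2) slopes_subset
      by (intro bexI[of _ "ride \<rho>"] exI[of _ 1]) auto
  next
    case False
    \<comment> \<open>On admissible slopes \<open>vm\<close> increases the slope and \<open>vp\<close> decreases it, whatever the sign of \<open>l\<close>.\<close>
    define v where "v = (if \<rho> < \<rho>' then vm else vp)"
    let ?d = "(l - v) * \<rho> - l" and ?d' = "(l - v) * \<rho>' - l"
    have sgn: "0 < (\<rho>' - \<rho>) / ?d" "0 < ?d' / ?d"
      using assms(2,3) False by (auto simp: v_def slopes_def zero_less_divide_iff)
    then have d: "?d \<noteq> 0" by auto
    have "1 + (l - v) * ((\<rho>' - \<rho>) / ?d) = ?d' / ?d"
      using d by (simp add: field_simps)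
    then obtain S where S: "S > 0" "exp_integral (l - v) S = (\<rho>' - \<rho>) / ?d"
      using exp_integral_surj[OF sgn(1), of "l - v"] sgn(2) by auto
    have "v \<in> {vm..vp}" using vm_neg vp_pos by (auto simp: v_def)
    with S d show ?thesis by (intro bexI[of _ v] exI[of _ S]) auto
  qed
  then obtain v S where vS: "v \<in> {vm..vp}" "S > 0"
    "\<rho> + ((l - v) * \<rho> - l) * exp_integral (l - v) S = \<rho>'" by blast
  have "cone_reach t \<rho> z (t + v * S) \<rho>' (z + \<omega> * (t * S + v * S\<^sup>2 / 2))" for t z
    using cone_reach_const[OF assms(1) vS(1,2), of t \<rho> z] unfolding vS(3) .
  then show ?thesis by blast
qed

text \<open>Riding along a slope \<open>a\<close> with velocity \<open>\<epsilon>\<close> and along a slope \<open>b\<close> with velocity \<open>- \<epsilon>\<close> corrects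
  the value of \<open>t\<close> that the three transfers between \<open>\<rho>\<close>, \<open>a\<close>, \<open>b\<close> and \<open>\<rho>'\<close> produce.\<close>

lemma cone_reach_affine:
  assumes "l \<noteq> 0" "\<rho> \<in> slopes" "\<rho>' \<in> slopes"
  shows "\<exists>L. \<forall>z. cone_reach t \<rho> z t' \<rho>' (z + L)"
proof -
  \<comment> \<open>\<open>\<epsilon> < \<bar>l\<bar>\<close> makes the slopes \<open>a\<close> and \<open>b\<close> positive; the other bounds make them admissible.\<close>
  define \<epsilon> where "\<epsilon> = min (min vp (- vm)) \<bar>l\<bar> / 2"
  have \<epsilon>: "0 < \<epsilon>" "\<epsilon> < vp" "\<epsilon> < - vm" "\<epsilon> < \<bar>l\<bar>"
    using assms(1) vm_neg vp_pos by (auto simp: \<epsilon>_def min_def)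
  define a where "a = l / (l - \<epsilon>)"
  define b where "b = l / (l + \<epsilon>)"
  have ab: "a > 0" "b > 0" "(l - \<epsilon>) * a = l" "(l + \<epsilon>) * b = l"
    using \<epsilon> by (auto simp: a_def b_def zero_less_divide_iff abs_if split: if_splits)
  have a: "a \<in> slopes"
  proof -
    have "(l - vp) * a < (l - \<epsilon>) * a" "(l - \<epsilon>) * a < (l - vm) * a"
      using ab(1) \<epsilon> vm_neg by (auto intro!: mult_strict_right_mono)
    then show ?thesis unfolding ab(3) by (simp add: slopes_def)
  qed
  have b: "b \<in> slopes"
  proof -
    have "(l - vp) * b < (l + \<epsilon>) * b" "(l + \<epsilon>) * b < (l - vm) * b"
      using ab(2) \<epsilon> vp_pos by (auto intro!: mult_strict_right_mono)
    then show ?thesis unfolding ab(4) by (simp add: slopes_def)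
  qed
  have ride: "ride a = \<epsilon>" "ride b = - \<epsilon>"
    using ab assms(1) by (auto simp: ride_def field_simps)
  obtain T1 where 1: "\<And>t. \<exists>L. \<forall>z. cone_reach t \<rho> z (t + T1) a (z + L)"
    using cone_reach_transfer[OF assms(1,2) a] by blast
  obtain T2 where 2: "\<And>t. \<exists>L. \<forall>z. cone_reach t a z (t + T2) b (z + L)"
    using cone_reach_transfer[OF assms(1) a b] by blast
  obtain T3 where 3: "\<And>t. \<exists>L. \<forall>z. cone_reach t b z (t + T3) \<rho>' (z + L)"
    using cone_reach_transfer[OF assms(1) b assms(3)] by blast
  define c where "c = (t' - t - T1 - T2 - T3) / \<epsilon>"
  \<comment> \<open>Any two positive times with difference \<open>c\<close> serve.\<close>
  define S1 where "S1 = max c 0 + 1"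
  define S2 where "S2 = max (- c) 0 + 1"
  have S: "S1 > 0" "S2 > 0" by (auto simp: S1_def S2_def)
  have "S1 - S2 = c" by (auto simp: S1_def S2_def)
  then have "\<epsilon> * (S1 - S2) = t' - t - T1 - T2 - T3" using \<epsilon>(1) by (simp add: c_def)
  then have time: "t + T1 + \<epsilon> * S1 + T2 + (- \<epsilon>) * S2 + T3 = t'" by (simp add: algebra_simps)
  obtain L1 where L1: "\<And>z. cone_reach t \<rho> z (t + T1) a (z + L1)" using 1 by blast
  obtain L2 where L2: "\<And>z. cone_reach (t + T1 + \<epsilon> * S1) a z (t + T1 + \<epsilon> * S1 + T2) b (z + L2)"
    using 2 by blast
  obtain L3 where L3: "\<And>z. cone_reach (t + T1 + \<epsilon> * S1 + T2 + (- \<epsilon>) * S2) b z t' \<rho>' (z + L3)"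
    using 3[of "t + T1 + \<epsilon> * S1 + T2 + (- \<epsilon>) * S2"] unfolding time by blast
  have a': "a \<in> closed_slopes" and b': "b \<in> closed_slopes" using a b slopes_subset by auto
  have "\<exists>M. \<forall>z. cone_reach t \<rho> z t' \<rho>' (z + M)"
  proof (rule exI, rule allI)
    fix z
    note cone_reach_trans[OF L1[of z] cone_reach_ride[OF assms(1) a' S(1), unfolded ride]]
    note cone_reach_trans[OF this L2]
    note cone_reach_trans[OF this cone_reach_ride[OF assms(1) b' S(2), unfolded ride]]
    from cone_reach_trans[OF this L3] show "cone_reach t \<rho> z t' \<rho>' (z + (L1 + \<omega> * ((t + T1) * S1 + \<epsilon> * S1\<^sup>2 / 2)
      + L2 + \<omega> * ((t + T1 + \<epsilon> * S1 + T2) * S2 + - \<epsilon> * S2\<^sup>2 / 2) + L3))"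
      by (simp only: add.assoc)
  qed
  then show ?thesis .
qed

text \<open>The detour through \<open>t = 1\<close>, \<open>\<rho> = 1\<close> allows a pause with zero control in which only the angle
  changes, at the nonzero rate \<open>\<omega>\<close>.\<close>

lemma cone_reach_slopes:
  assumes "l \<noteq> 0" "\<rho> \<in> slopes" "\<rho>' \<in> slopes"
  shows "cone_point t' \<rho>' z' \<in> orbit_S1 (cone_point t \<rho> z)"
proof -
  obtain L1 where L1: "\<And>z. cone_reach t \<rho> z 1 1 (z + L1)"
    using cone_reach_affine[OF assms(1,2) one_in_slopes] by blast
  obtain L2 where L2: "\<And>z. cone_reach 1 1 z t' \<rho>' (z + L2)"
    using cone_reach_affine[OF assms(1) one_in_slopes assms(3)] by blast
  obtain k :: int where k: "0 < (z' - z - L1 - L2 + 2 * pi * of_int k) / \<omega>"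
    using ex_period_above[OF nonzero(2)] by blast
  define S where "S = (z' - z - L1 - L2 + 2 * pi * of_int k) / \<omega>"
  have "ride 1 = 0" by (simp add: ride_def)
  moreover have "1 \<in> closed_slopes" using one_in_slopes slopes_subset by auto
  ultimately have "cone_reach 1 1 (z + L1) 1 1 (z + L1 + \<omega> * S)"
    using cone_reach_ride[OF assms(1), of 1 S 1 "z + L1"] k by (simp add: S_def)
  then have "cone_reach t \<rho> z t' \<rho>' (z + L1 + \<omega> * S + L2)"
    by (rule cone_reach_trans[OF cone_reach_trans[OF L1] L2])
  also have "z + L1 + \<omega> * S + L2 = z' + 2 * pi * of_int k"
    using nonzero(2) by (simp add: S_def)
  finally show ?thesis by (simp add: cone_reach_def cone_point_def point_period)
qed

end


section \<open>The control sets\<close>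

context affine_circle_system
begin

text \<open>Upper bounds for control sets lift from the affine group to the product, because projections
  keep nonempty interiors; being a control set up to maximality descends from the product to the
  affine group. Hence each half of the work is done on one of the two spaces only.\<close>

lemma control_sets_eq:
  assumes pre: "pre_control_S1 (fst -` C)" and int: "interior C \<noteq> {}"
    and max: "\<And>D. \<lbrakk>pre_control_Aff D; interior D \<noteq> {}\<rbrakk> \<Longrightarrow> D \<subseteq> C"
  shows "control_set shift_S1 X Y {um..up} D \<and> interior D \<noteq> {} \<longleftrightarrow> D = fst -` C"
    and "control_set shift_Aff X' Y' {um..up} E \<and> interior E \<noteq> {} \<longleftrightarrow> E = C"
proof -
  have sub: "D \<subseteq> fst -` C" if "pre_control_S1 D" "interior D \<noteq> {}" for D
    using max[OF pre_control_set_fst[OF that(1) projects] interior_fst_image[OF that(2)]] by blast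
  have "interior C \<times> UNIV \<subseteq> interior (fst -` C :: ((real \<times> real) \<times> circle) set)"
    using interior_subset[of C] by (intro interior_maximal open_Times) auto
  then have "interior (fst -` C :: ((real \<times> real) \<times> circle) set) \<noteq> {}" using int by auto
  from unique_control_set_with_interior[OF pre this sub]
  show "control_set shift_S1 X Y {um..up} D \<and> interior D \<noteq> {} \<longleftrightarrow> D = fst -` C" .
  have "fst ` (fst -` C :: ((real \<times> real) \<times> circle) set) = C" by auto
  with pre_control_set_fst[OF pre projects] have "pre_control_Aff C" by metis
  from unique_control_set_with_interior[OF this int max]
  show "control_set shift_Aff X' Y' {um..up} E \<and> interior E \<noteq> {} \<longleftrightarrow> E = C" .
qed

lemma pre_control_trace_zero:
  assumes "l = 0"
  shows "pre_control_S1 UNIV"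
  unfolding pre_control_set_def
proof (intro conjI ballI)
  fix m
  obtain t w z where m: "m = point t w z" using ex_point by blast
  have w: "((\<lambda>s. w + \<kappa> * (exp t - 1) * s) has_real_derivative
      l * (w + \<kappa> * (exp t - 1) * s) + \<kappa> * (exp (t + 0 * s) - 1)) (at s)" for s
    by (auto intro!: derivative_eq_intros simp: assms)
  show "\<exists>u\<in>controls {um..up}. \<exists>\<gamma>. is_solution shift_S1 X Y u m \<gamma> \<and> (\<forall>s>0. \<gamma> s \<in> UNIV)"
    using constant_control_solution[OF w, of z] constant_velocity_in_controls[of 0] vm_neg vp_pos
    unfolding m by auto
  have "m' \<in> orbit_S1 m" for m' using reach_trace_zero[OF assms] m ex_point by metis
  then show "UNIV \<subseteq> closure (orbit_S1 m)" using closure_subset by blast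
qed

lemma ride_solution:
  assumes "l \<noteq> 0" "\<rho> \<in> closed_slopes"
  shows "is_solution shift_S1 X Y (\<lambda>_. ride \<rho> / \<alpha>) (cone_point t \<rho> z)
    (\<lambda>s. cone_point (t + ride \<rho> * s) \<rho> (z + \<omega> * (t * s + ride \<rho> * s\<^sup>2 / 2)))"
  using constant_control_solution[OF cone_flow_deriv[OF assms(1), of \<rho> "ride \<rho>" t], of z]
    ride_in_range(2)[OF assms] by (simp add: cone_point_def)

lemma cone_invariant_solution:
  assumes "l \<noteq> 0" "I \<subseteq> closed_slopes" "r (fst m) \<in> I"
  shows "\<exists>u\<in>controls {um..up}. \<exists>\<gamma>. is_solution shift_S1 X Y u m \<gamma> \<and> (\<forall>s>0. \<gamma> s \<in> fst -` {p. r p \<in> I})"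
proof -
  obtain t z where m: "m = cone_point t (r (fst m)) z" using ex_cone_point[OF assms(1)] by blast
  have c: "r (fst m) \<in> closed_slopes" using assms(2,3) by blast
  let ?\<gamma> = "\<lambda>s. cone_point (t + ride (r (fst m)) * s) (r (fst m)) (z + \<omega> * (t * s + ride (r (fst m)) * s\<^sup>2 / 2))"
  have "is_solution shift_S1 X Y (\<lambda>_. ride (r (fst m)) / \<alpha>) m ?\<gamma>"
    using ride_solution[OF assms(1) c, of t z] m by simp
  moreover have "\<forall>s>0. ?\<gamma> s \<in> fst -` {p. r p \<in> I}" using assms r_cone_point by simp
  ultimately show ?thesis
    using constant_velocity_in_controls[OF ride_in_range(1)[OF assms(1) c]] by blast
qed

lemma orbit_from_slopes:
  assumes "l \<noteq> 0" "r (fst m) \<in> slopes" "r (fst m') \<in> slopes"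
  shows "m' \<in> orbit_S1 m"
  using cone_reach_slopes[OF assms] ex_cone_point[OF assms(1)] by metis

lemma pre_control_trace_pos:
  assumes "l > 0"
  shows "pre_control_S1 (fst -` {p. r p \<in> slopes})"
  unfolding pre_control_set_def
  using orbit_from_slopes assms closure_subset cone_invariant_solution[OF _ slopes_subset]
  by (intro conjI ballI) (fastforce, blast)

text \<open>The zero control contracts slopes towards \<open>1\<close>, which pushes boundary slopes inside.\<close>

lemma orbit_meets_slopes:
  assumes "l < 0" "\<rho> \<in> closed_slopes"
  shows "\<exists>t' \<rho>' z'. \<rho>' \<in> slopes \<and> cone_reach t \<rho> z t' \<rho>' z'"
proof -
  have c: "cone_reach t \<rho> z (t + 0 * 1) (\<rho> + ((l - 0) * \<rho> - l) * exp_integral (l - 0) 1) (z + \<omega> * (t * 1 + 0 * 1\<^sup>2 / 2))"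
    using assms vm_neg vp_pos by (intro cone_reach_const) auto
  define \<mu> where "\<mu> = exp l"
  have \<mu>: "0 < \<mu>" "\<mu> < 1" using assms by (auto simp: \<mu>_def)
  have "\<rho> + ((l - 0) * \<rho> - l) * exp_integral (l - 0) 1 = \<rho> + (\<rho> - 1) * (l * exp_integral l 1)"
    by (simp add: algebra_simps)
  also have "\<dots> = \<mu> * \<rho> + (1 - \<mu>) * 1" by (simp add: exp_integral_eq \<mu>_def algebra_simps)
  finally have eq: "\<rho> + ((l - 0) * \<rho> - l) * exp_integral (l - 0) 1 = \<mu> * \<rho> + (1 - \<mu>) * 1" .
  have "\<mu> * \<rho> + (1 - \<mu>) * 1 \<in> slopes"
  proof -
    have "\<mu> * ((l - vp) * \<rho>) \<le> \<mu> * l" "\<mu> * l \<le> \<mu> * ((l - vm) * \<rho>)"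
      using assms(2) \<mu> by (auto simp: closed_slopes_def)
    moreover have "(1 - \<mu>) * (l - vp) < (1 - \<mu>) * l" "(1 - \<mu>) * l < (1 - \<mu>) * (l - vm)"
      using \<mu> vm_neg vp_pos by auto
    ultimately show ?thesis unfolding slopes_def by (simp add: algebra_simps)
  qed
  with c show ?thesis unfolding eq by blast
qed

lemma closed_slopes_closure: "closed_slopes \<subseteq> closure slopes"
proof
  fix \<rho> assume \<rho>: "\<rho> \<in> closed_slopes"
  show "\<rho> \<in> closure slopes"
  proof (cases "\<rho> = 1")
    case True
    then show ?thesis using one_in_slopes closure_subset by blast
  next
    case False
    have "open_segment \<rho> 1 \<subseteq> slopes"
    proof
      fix y assume "y \<in> open_segment \<rho> 1"
      then obtain a where a: "0 < a" "a < 1" "y = (1 - a) * \<rho> + a * 1"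
        using False by (auto simp: in_segment)
      have "(1 - a) * ((l - vp) * \<rho>) \<le> (1 - a) * l" "(1 - a) * l \<le> (1 - a) * ((l - vm) * \<rho>)"
        using \<rho> a by (auto simp: closed_slopes_def)
      moreover have "a * (l - vp) < a * l" "a * l < a * (l - vm)" using a vm_neg vp_pos by auto
      ultimately show "y \<in> slopes" unfolding slopes_def a(3) by (simp add: algebra_simps)
    qed
    then have "closed_segment \<rho> 1 \<subseteq> closure slopes"
      using closure_mono closure_open_segment[of \<rho> 1] False by metis
    then show ?thesis by auto
  qed
qed

lemma continuous_cone_point: "continuous_on A (\<lambda>\<rho>. cone_point t \<rho> z)"
  unfolding cone_point_def point_def by (intro continuous_intros)

text \<open>Boundary points need only be approximated: the reachable slopes include the open
  interval, and its closure is the closed one.\<close>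

lemma pre_control_trace_neg:
  assumes "l < 0"
  shows "pre_control_S1 (fst -` {p. r p \<in> closed_slopes})"
  unfolding pre_control_set_def
proof (intro conjI ballI)
  fix m :: "(real \<times> real) \<times> circle"
  assume m: "m \<in> fst -` {p. r p \<in> closed_slopes}"
  then show "\<exists>u\<in>controls {um..up}. \<exists>\<gamma>. is_solution shift_S1 X Y u m \<gamma> \<and>
      (\<forall>s>0. \<gamma> s \<in> fst -` {p. r p \<in> closed_slopes})"
    using assms by (intro cone_invariant_solution) auto
  show "fst -` {p. r p \<in> closed_slopes} \<subseteq> closure (orbit_S1 m)"
  proof
    fix m' :: "(real \<times> real) \<times> circle"
    assume m': "m' \<in> fst -` {p. r p \<in> closed_slopes}"
    obtain t z where mtz: "m = cone_point t (r (fst m)) z" using ex_cone_point assms by blast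
    obtain t' z' where m'tz: "m' = cone_point t' (r (fst m')) z'" using ex_cone_point assms by blast
    have "r (fst m) \<in> closed_slopes" using m by simp
    from orbit_meets_slopes[OF assms this, of t z]
    obtain s \<rho> y where "\<rho> \<in> slopes" "cone_point s \<rho> y \<in> orbit_S1 m"
      unfolding cone_reach_def mtz[symmetric] by blast
    then obtain n where n: "r (fst n) \<in> slopes" "n \<in> orbit_S1 m"
      using r_cone_point assms by (metis less_irrefl)
    let ?f = "\<lambda>\<rho>. cone_point t' \<rho> z'"
    have "?f \<rho> \<in> orbit_S1 m" if "\<rho> \<in> slopes" for \<rho>
      using positive_orbit_trans[OF n(2)] orbit_from_slopes[OF _ n(1)] assms that r_cone_point by simp
    then have "?f ` closure slopes \<subseteq> closure (orbit_S1 m)"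
      by (intro image_closure_subset continuous_cone_point closed_closure)
        (use closure_subset in blast)
    moreover have "r (fst m') \<in> closure slopes" using m' closed_slopes_closure by auto
    ultimately show "m' \<in> closure (orbit_S1 m)" using m'tz by (metis image_subset_iff)
  qed
qed

lemma open_slope_cone: "open {p. r p \<in> slopes}"
  unfolding slopes_def mem_Collect_eq
  by (intro open_Collect_conj open_Collect_less continuous_intros continuous_on_r)

lemma closed_slope_cone: "closed {p. r p \<in> closed_slopes}"
  unfolding closed_slopes_def mem_Collect_eq
  by (intro closed_Collect_conj closed_Collect_le continuous_intros continuous_on_r)

lemma interior_slope_cone:
  assumes "l \<noteq> 0" "slopes \<subseteq> I"
  shows "interior {p. r p \<in> I} \<noteq> {}"
proof -
  have "{p. r p \<in> slopes} \<subseteq> interior {p. r p \<in> I}"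
    using assms(2) open_slope_cone by (intro interior_maximal) auto
  moreover have "r (fst (cone_point 0 1 0)) \<in> slopes" using r_cone_point[OF assms(1)] one_in_slopes by simp
  ultimately show ?thesis by blast
qed

theorem control_sets_with_interior:
  "\<exists>C C_Aff.
    (\<forall>D. control_set shift_S1 X Y {um..up} D \<and> interior D \<noteq> {} \<longleftrightarrow> D = C) \<and>
    (\<forall>D. control_set shift_Aff X' Y' {um..up} D \<and> interior D \<noteq> {} \<longleftrightarrow> D = C_Aff) \<and>
    C = fst -` C_Aff \<and> C = C_Aff \<times> UNIV \<and>
    (l > 0 \<longrightarrow> open C) \<and> (l < 0 \<longrightarrow> closed C) \<and> (l = 0 \<longrightarrow> C = UNIV)"
proof -
  have "\<exists>C. pre_control_S1 (fst -` C) \<and> interior C \<noteq> {} \<and>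
      (\<forall>D. pre_control_Aff D \<longrightarrow> interior D \<noteq> {} \<longrightarrow> D \<subseteq> C) \<and>
      (l > 0 \<longrightarrow> open C) \<and> (l < 0 \<longrightarrow> closed C) \<and> (l = 0 \<longrightarrow> C = UNIV)"
  proof (cases l "0::real" rule: linorder_cases)
    case less
    then show ?thesis
      using pre_control_trace_neg interior_slope_cone[OF _ slopes_subset] closed_slope_cone
        pre_control_set_bounds_neg
      by (intro exI[of _ "{p. r p \<in> closed_slopes}"]) (auto simp: closed_slopes_def)
  next
    case equal
    then show ?thesis using pre_control_trace_zero by (intro exI[of _ UNIV]) auto
  next
    case greater
    then show ?thesis
      using pre_control_trace_pos interior_slope_cone[OF _ subset_refl] open_slope_cone
        pre_control_set_bounds_pos
      by (intro exI[of _ "{p. r p \<in> slopes}"]) (auto simp: slopes_def)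
  qed
  then obtain C where C: "pre_control_S1 (fst -` C)" "interior C \<noteq> {}"
      "\<And>D. \<lbrakk>pre_control_Aff D; interior D \<noteq> {}\<rbrakk> \<Longrightarrow> D \<subseteq> C"
      "l > 0 \<longrightarrow> open C" "l < 0 \<longrightarrow> closed C" "l = 0 \<longrightarrow> C = UNIV" by blast
  have "(fst -` C :: ((real \<times> real) \<times> circle) set) = C \<times> UNIV" by auto
  then show ?thesis
    using control_sets_eq[OF C(1-3)] C(4-6)
    by (intro exI[of _ "fst -` C"] exI[of _ C]) (auto intro: open_Times closed_Times)
qed

end

section \<open>The linear control system on \<open>Aff(\<real>) \<times> S\<^sup>1\<close>\<close>

theorem theorem5p3:
  fixes A :: "real^2^2" and \<xi> \<eta> :: "real^2" and \<alpha> um up :: real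
    and X Y :: "(real \<times> real) \<times> circle \<Rightarrow> (real \<times> real) \<times> real"
    and X' Y' :: "real \<times> real \<Rightarrow> real \<times> real"
  assumes "A ** theta = theta ** A" and "A *v axis 2 1 = 0"
    and "um < 0" and "0 < up"
    and "projects_to proj_S1 dproj_S1 (linear_field A \<xi>) X"
    and "projects_to proj_S1 dproj_S1 (left_invariant_field \<alpha> \<eta>) Y"
    and "projects_to fst fst X X'"
    and "projects_to fst fst Y Y'"
    and "LARC shift_S1 X Y"
  shows "\<exists>C C_Aff.
    (\<forall>D. control_set shift_S1 X Y {um..up} D \<and> interior D \<noteq> {} \<longleftrightarrow> D = C) \<and>
    (\<forall>D. control_set shift_Aff X' Y' {um..up} D \<and> interior D \<noteq> {} \<longleftrightarrow> D = C_Aff) \<and>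
    C = fst -` C_Aff \<and>
    C = C_Aff \<times> UNIV \<and>
    (trace A > 0 \<longrightarrow> open C) \<and>
    (trace A < 0 \<longrightarrow> closed C) \<and>
    (trace A = 0 \<longrightarrow> C = UNIV)"
proof -
  have X: "X = (\<lambda>((t, x), z). ((0, trace A * x + (exp t - 1) * \<xi> $ 1), t * \<xi> $ 2))"
    using assms(5) linear_field_projects_iff[OF assms(1,2)] by blast
  have Y: "Y = (\<lambda>((t, x), z). ((\<alpha>, exp t * \<eta> $ 1), \<eta> $ 2))"
    using assms(6) left_invariant_field_projects_iff by blast
  have "X = affine_exp_field 0 (trace A) (\<xi> $ 1) (- \<xi> $ 1) (\<xi> $ 2) 0"
    and "Y = affine_exp_field \<alpha> 0 (\<eta> $ 1) 0 0 (\<eta> $ 2)"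
    unfolding X Y by (auto simp: affine_exp_field_def fun_eq_iff algebra_simps)
  then have nz: "\<alpha> \<noteq> 0" "\<xi> $ 2 \<noteq> 0" "\<alpha> * \<xi> $ 1 + trace A * \<eta> $ 1 \<noteq> 0"
    using LARC_affine_exp_nonzero assms(9) by metis+
  define \<beta> where "\<beta> = \<eta> $ 1 / \<alpha>"
  define \<delta> where "\<delta> = \<eta> $ 2 / \<alpha>"
  define \<kappa> where "\<kappa> = \<xi> $ 1 + trace A * \<beta>"
  have "\<kappa> \<noteq> 0" using nz by (simp add: \<kappa>_def \<beta>_def field_simps)
  then interpret S: affine_circle_system "trace A" \<kappa> \<beta> "\<xi> $ 2" \<delta> \<alpha> um up
    using nz assms(3,4) by unfold_locales auto
  have XY: "X = S.X" "Y = S.Y"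
    unfolding X Y S.X_def S.Y_def using nz(1) by (auto simp: \<kappa>_def \<beta>_def \<delta>_def fun_eq_iff)
  have "X' p = S.X' p" "Y' p = S.Y' p" for p
    using assms(7,8) S.projects unfolding XY projects_to_def by (metis fst_conv)+
  then have XY': "X' = S.X'" "Y' = S.Y'" by auto
  show ?thesis unfolding XY XY' by (rule S.control_sets_with_interior)
qed

end
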